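(* There exist an additive subgroup $A$ of $\mathbb{R}$ which is an $F_\sigma$ set, and a real $x\in\mathbb{R}$, such that $\dim_H(A)=\frac{1}{2}$ and $A+xA=\mathbb{R}$. Moreover, assuming the continuum hypothesis $2^{\aleph_0}=\aleph_1$, there is an additive subgroup $A$ of $\mathbb{R}$ with $\dim_H(A)=0$ such that for every $x\in\mathbb{R}$: $x\notin\mathbb{Q}$ if and only if $A+xA=\mathbb{R}$.
   Context: $\dim_H$ denotes Hausdorff dimension. For $A\subseteq\mathbb{R}$ and $x\in\mathbb{R}$, $A+xA=\{a+xb: a,b\in A\}$. *)

theory Defs
  imports "HOL-Analysis.Analysis" "HOL-Algebra.Group"
begin

text \<open>The term \<open>(diam U)\<^sup>s\<close> of a Hausdorff sum. The case distinction implements the usual conventions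
  that the empty set contributes \<open>0\<close> and that \<open>0\<^sup>0 = 1\<close> for nonempty sets (so that the
  0-dimensional measure is counting measure), whereas \<open>0 powr 0 = 0\<close> in the library.\<close>

definition diam_power :: "real \<Rightarrow> 'a::metric_space set \<Rightarrow> ennreal" where
  "diam_power s U = (if U = {} then 0 else if s = 0 then 1 else ennreal (diameter U powr s))"

text \<open>Boundedness of the covering sets is required explicitly because \<^const>\<open>diameter\<close> is
  real-valued and carries no information for unbounded sets.\<close>

definition hausdorff_premeasure :: "real \<Rightarrow> real \<Rightarrow> 'a::metric_space set \<Rightarrow> ennreal" where
  "hausdorff_premeasure s \<delta> A =
     (INF U \<in> {U :: nat \<Rightarrow> 'a set. A \<subseteq> (\<Union>i. U i) \<and> (\<forall>i. bounded (U i) \<and> diameter (U i) \<le> \<delta>)}.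
        \<Sum>i. diam_power s (U i))"

definition hausdorff_measure :: "real \<Rightarrow> 'a::metric_space set \<Rightarrow> ennreal" where
  "hausdorff_measure s A = (SUP \<delta> \<in> {0<..}. hausdorff_premeasure s \<delta> A)"

definition hausdorff_dim :: "'a::metric_space set \<Rightarrow> ennreal" where
  "hausdorff_dim A = (INF s \<in> {s. 0 \<le> s \<and> hausdorff_measure s A = 0}. ennreal s)"

definition real_add_group :: "real monoid" where
  "real_add_group = \<lparr>carrier = UNIV, monoid.mult = (+), one = 0\<rparr>"

lemma group_real_add_group: "group real_add_group"
proof (rule groupI; simp add: real_add_group_def)
  show "\<exists>y. y + x = 0" for x :: real
    by (rule exI[of _ "- x"]) simp
qed

lemma inv_real_add_group: "inv\<^bsub>real_add_group\<^esub> x = - x"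
  by (rule group.inv_equality [OF group_real_add_group]) (auto simp: real_add_group_def)

lemma subgroup_real_add_group_iff:
  "subgroup A real_add_group \<longleftrightarrow> 0 \<in> A \<and> (\<forall>x\<in>A. \<forall>y\<in>A. x + y \<in> A) \<and> (\<forall>x\<in>A. - x \<in> A)"
  by (auto simp: subgroup_def inv_real_add_group) (auto simp: real_add_group_def)

context
  includes cardinal_syntax
begin

definition continuum_hypothesis :: bool where
  "continuum_hypothesis \<longleftrightarrow> ctwo ^c natLeq =o cardSuc natLeq"

end

end

(* For the first part, let A consist of the z for which the distance from 2^(k^2) z to the integers
   is O(2^-k). Asymptotically half of the binary digits are free, which gives dimension 1/2; the
   lower bound comes from an expanding map of [0,1) into A. For x take the golden ratio: its multiples
   a x with 0 <= a <= 2 * 2^k are O(2^-k)-dense modulo 1, so given y the digits of some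
   b = sum a_k 2^(-k^2) in A can be chosen successively so that y - x b lies in A.

   For the second part, fix a comeager set G that contains 0 and has dimension 0. Under CH the pairs
   (x,y) have a well-ordering with countable initial segments. For each pair with x irrational
   adjoin a generic b together with y - x b to the countable group built so far: every new element
   is g + m y + (n - m x) b with n - m x nonzero, so by Baire category b can be chosen such that all
   of them lie in G. For rational x = p/q, A + xA = R would give R = qR = A, contradicting
   that A is null. *)
theory Submission
  imports Defs "HOL-Library.Countable_Set_Type" "HOL-Number_Theory.Fib" "HOL-Number_Theory.Cong"
    "HOL-Real_Asymp.Real_Asymp"
begin

section \<open>Hausdorff measures\<close>

lemma hausdorff_premeasure_le:
  assumes "A \<subseteq> (\<Union>i. U i)" "\<And>i. bounded (U i)" "\<And>i. diameter (U i) \<le> \<delta>"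
  shows "hausdorff_premeasure s \<delta> A \<le> (\<Sum>i. diam_power s (U i))"
  unfolding hausdorff_premeasure_def using assms by (intro INF_lower) auto

lemma hausdorff_premeasure_less_cover:
  assumes "hausdorff_premeasure s \<delta> A < e"
  obtains U where "A \<subseteq> (\<Union>i. U i)" "\<And>i. bounded (U i)" "\<And>i. diameter (U i) \<le> \<delta>"
    "(\<Sum>i. diam_power s (U i)) < e"
  using assms unfolding hausdorff_premeasure_def INF_less_iff by blast

lemma hausdorff_measure_eq_0_iff:
  "hausdorff_measure s A = 0 \<longleftrightarrow> (\<forall>\<delta>>0. hausdorff_premeasure s \<delta> A = 0)"
  unfolding hausdorff_measure_def
  by (subst SUP_eq_iff) (auto intro: exI[of _ 1])

lemma hausdorff_measure_eq_0I:
  assumes "\<And>\<delta> e. \<delta> > 0 \<Longrightarrow> e > 0 \<Longrightarrow> hausdorff_premeasure s \<delta> A \<le> ennreal e"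
  shows "hausdorff_measure s A = 0"
  unfolding hausdorff_measure_eq_0_iff
proof (intro allI impI)
  fix \<delta> :: real assume "\<delta> > 0"
  then have "hausdorff_premeasure s \<delta> A \<le> 0 + ennreal e" if "e > 0" for e
    using assms that by simp
  then have "hausdorff_premeasure s \<delta> A \<le> 0"
    using ennreal_le_epsilon[of 0] by blast
  then show "hausdorff_premeasure s \<delta> A = 0" by simp
qed

lemma hausdorff_measure_mono:
  assumes "A \<subseteq> B"
  shows "hausdorff_measure s A \<le> hausdorff_measure s B"
  unfolding hausdorff_measure_def hausdorff_premeasure_def
  using assms by (intro SUP_mono' INF_superset_mono) auto

text \<open>The n-th set gets the share \<open>e * (1/2) ^ Suc n\<close> of the error, and the
  double family of covers is merged into one sequence along \<open>prod_decode\<close>.\<close>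

lemma hausdorff_measure_UN_eq_0:
  fixes A :: "nat \<Rightarrow> 'a::metric_space set"
  assumes "\<And>n. hausdorff_measure s (A n) = 0"
  shows "hausdorff_measure s (\<Union>n. A n) = 0"
proof (rule hausdorff_measure_eq_0I)
  fix \<delta> e :: real assume \<delta>: "\<delta> > 0" and e: "e > 0"
  have "\<exists>U. A n \<subseteq> (\<Union>i. U i) \<and> (\<forall>i. bounded (U i)) \<and> (\<forall>i. diameter (U i) \<le> \<delta>) \<and>
      (\<Sum>i. diam_power s (U i)) \<le> ennreal (e * (1/2) ^ Suc n)" for n
  proof -
    have "hausdorff_premeasure s \<delta> (A n) < ennreal (e * (1/2) ^ Suc n)"
      using assms[of n] \<delta> e by (simp add: hausdorff_measure_eq_0_iff)
    then show ?thesis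
      by (rule hausdorff_premeasure_less_cover) (meson less_imp_le)
  qed
  then obtain U where U: "\<And>n. A n \<subseteq> (\<Union>i. U n i)" "\<And>n i. bounded (U n i)"
      "\<And>n i. diameter (U n i) \<le> \<delta>"
      "\<And>n. (\<Sum>i. diam_power s (U n i)) \<le> ennreal (e * (1/2) ^ Suc n)"
    by metis
  let ?V = "\<lambda>k. case_prod U (prod_decode k)"
  have "(\<Union>n. A n) \<subseteq> (\<Union>k. ?V k)"
  proof
    fix x assume "x \<in> (\<Union>n. A n)"
    then obtain n i where "x \<in> U n i" using U(1) by fast
    then show "x \<in> (\<Union>k. ?V k)"
      by (intro UN_I[of "prod_encode (n, i)"]) auto
  qed
  then have "hausdorff_premeasure s \<delta> (\<Union>n. A n) \<le> (\<Sum>k. diam_power s (?V k))"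
    using U by (intro hausdorff_premeasure_le) (auto split: prod.split)
  also have "\<dots> = (\<Sum>k. (\<lambda>(n, i). diam_power s (U n i)) (prod_decode k))"
    by (simp add: case_prod_beta)
  also have "\<dots> = (\<Sum>n. \<Sum>i. diam_power s (U n i))"
    by (rule suminf_ennreal_2dimen) simp
  also have "\<dots> \<le> (\<Sum>n. ennreal (e * (1/2) ^ Suc n))"
    using U(4) by (intro suminf_le) auto
  also have "\<dots> = ennreal e"
  proof (rule suminf_ennreal_eq)
    show "(\<lambda>n. e * (1/2) ^ Suc n) sums e"
      using sums_mult[OF power_half_series, of e] by simp
  qed (use e in auto)
  finally show "hausdorff_premeasure s \<delta> (\<Union>n. A n) \<le> ennreal e" .
qed

text \<open>Turns a count of covering sets into a bound on the Hausdorff sum. Covers are infinite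
  sequences, so the finite one is padded with empty sets, which contribute 0.\<close>

lemma hausdorff_premeasure_le_finite_cover:
  fixes A :: "'a::metric_space set"
  assumes "finite T" "A \<subseteq> (\<Union>t\<in>T. V t)" "\<And>t. t \<in> T \<Longrightarrow> bounded (V t)"
    "\<And>t. t \<in> T \<Longrightarrow> diameter (V t) \<le> d" "0 \<le> d" "d \<le> \<delta>" "0 < s"
  shows "hausdorff_premeasure s \<delta> A \<le> ennreal (of_nat (card T) * d powr s)"
proof -
  define U where "U i = (if i < card T then V (from_nat_into T i) else {})" for i
  have T: "from_nat_into T i \<in> T" if "i < card T" for i
    using that by (intro from_nat_into) auto
  have "A \<subseteq> (\<Union>i. U i)"
  proof
    fix x assume "x \<in> A"
    then obtain t where t: "t \<in> T" "x \<in> V t" using assms(2) by blast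
    then obtain i where "i < card T" "from_nat_into T i = t"
      using bij_betw_from_nat_into_finite[OF \<open>finite T\<close>]
      by (metis bij_betw_def imageE lessThan_iff)
    then have "x \<in> U i" using t by (simp add: U_def)
    then show "x \<in> (\<Union>i. U i)" by blast
  qed
  moreover have "bounded (U i)" "diameter (U i) \<le> \<delta>" for i
    using assms(3-6) T[of i] by (auto simp: U_def intro: order_trans)
  ultimately have "hausdorff_premeasure s \<delta> A \<le> (\<Sum>i. diam_power s (U i))"
    by (rule hausdorff_premeasure_le)
  also have "\<dots> = (\<Sum>i<card T. diam_power s (U i))"
    by (rule suminf_finite) (auto simp: U_def diam_power_def)
  also have "\<dots> \<le> (\<Sum>i<card T. ennreal (d powr s))"
  proof (rule sum_mono)
    fix i assume "i \<in> {..<card T}"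
    then have i: "i < card T" by simp
    have "diameter (U i) powr s \<le> d powr s"
      using assms(3,4,7) T[OF i] i by (intro powr_mono2) (auto simp: U_def intro: diameter_ge_0)
    then show "diam_power s (U i) \<le> ennreal (d powr s)"
      using \<open>0 < s\<close> by (simp add: diam_power_def ennreal_leI)
  qed
  also have "\<dots> = ennreal (of_nat (card T) * d powr s)"
    by (simp add: ennreal_mult' ennreal_of_nat_eq_real_of_nat)
  finally show ?thesis .
qed

text \<open>A cover of \<open>g ` {0..<1}\<close> pulls back to a cover of the unit interval by sets of
  length at most \<open>2 * C\<close> times the terms of the Hausdorff sum.\<close>

lemma hausdorff_measure_ne_0_if_expanding:
  fixes g :: "real \<Rightarrow> 'a::metric_space" and A :: "'a set"
  assumes g: "\<And>y. 0 \<le> y \<Longrightarrow> y < 1 \<Longrightarrow> g y \<in> A"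
    and expand: "\<And>y z. \<lbrakk>0 \<le> y; y < 1; 0 \<le> z; z < 1\<rbrakk> \<Longrightarrow> \<bar>y - z\<bar> \<le> C * dist (g y) (g z) powr s"
    and "0 \<le> s" "0 < C"
  shows "hausdorff_measure s A \<noteq> 0"
proof
  assume "hausdorff_measure s A = 0"
  \<comment> \<open>This threshold brings the total length of the pulled-back intervals below
    1.\<close>
  then have "hausdorff_premeasure s 1 A < ennreal (1 / (2 * C))"
    using \<open>0 < C\<close> by (simp add: hausdorff_measure_eq_0_iff)
  then obtain U where U: "A \<subseteq> (\<Union>i. U i)" "\<And>i. bounded (U i)"
      "(\<Sum>i. diam_power s (U i)) < ennreal (1 / (2 * C))"
    by (rule hausdorff_premeasure_less_cover) blast
  \<comment> \<open>The preimage of \<open>U i\<close> need not be measurable, so it is enclosed in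
    an interval.\<close>
  have "\<exists>W \<in> sets lborel. {y. 0 \<le> y \<and> y < 1 \<and> g y \<in> U i} \<subseteq> W \<and>
      emeasure lborel W \<le> ennreal (2 * C) * diam_power s (U i)" for i
  proof (cases "\<exists>y. 0 \<le> y \<and> y < 1 \<and> g y \<in> U i")
    case False
    then show ?thesis by (intro bexI[of _ "{}"]) auto
  next
    case True
    then obtain y where y: "0 \<le> y" "y < 1" "g y \<in> U i" by blast
    \<comment> \<open>For s = 0 a nonempty set counts as 1 in \<open>diam_power\<close>, even when
      its diameter is 0 and \<open>powr\<close> would give 0.\<close>
    define L where "L = C * (if s = 0 then 1 else diameter (U i) powr s)"
    have L: "L \<ge> 0" using \<open>0 < C\<close> by (simp add: L_def)
    have "\<bar>y - z\<bar> \<le> L" if z: "0 \<le> z" "z < 1" "g z \<in> U i" for z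
    proof -
      have "dist (g y) (g z) powr s \<le> (if s = 0 then 1 else diameter (U i) powr s)"
        using diameter_bounded_bound[OF U(2) y(3) z(3)] \<open>0 \<le> s\<close> by (auto intro: powr_mono2)
      then have "C * dist (g y) (g z) powr s \<le> L"
        unfolding L_def using \<open>0 < C\<close> by (intro mult_left_mono) auto
      then show ?thesis using expand[of y z] y z by linarith
    qed
    then have "{z. 0 \<le> z \<and> z < 1 \<and> g z \<in> U i} \<subseteq> {y - L..y + L}"
      by (force simp: abs_le_iff)
    moreover have "emeasure lborel {y - L..y + L} = ennreal (2 * L)"
      using L by simp
    moreover have "ennreal (2 * L) = ennreal (2 * C) * diam_power s (U i)"
      using y(3) \<open>0 < C\<close> by (auto simp: L_def diam_power_def ennreal_mult' simp flip: mult.assoc)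
    ultimately show ?thesis by (intro bexI[of _ "{y - L..y + L}"]) auto
  qed
  then have "\<exists>W. \<forall>i. W i \<in> sets lborel \<and> {y. 0 \<le> y \<and> y < 1 \<and> g y \<in> U i} \<subseteq> W i \<and>
      emeasure lborel (W i) \<le> ennreal (2 * C) * diam_power s (U i)"
    unfolding Bex_def by (intro choice) blast
  then obtain W where W: "\<And>i. W i \<in> sets lborel"
      "\<And>i. {y. 0 \<le> y \<and> y < 1 \<and> g y \<in> U i} \<subseteq> W i"
      "\<And>i. emeasure lborel (W i) \<le> ennreal (2 * C) * diam_power s (U i)"
    by blast
  have "1 = emeasure lborel {0..<1::real}" by simp
  also have "\<dots> \<le> emeasure lborel (\<Union>i. W i)"
  proof (rule emeasure_mono)
    show "{0..<1} \<subseteq> (\<Union>i. W i)"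
    proof
      fix y :: real assume y: "y \<in> {0..<1}"
      then obtain i where "g y \<in> U i" using g[of y] U(1) by auto
      then show "y \<in> (\<Union>i. W i)" using W(2)[of i] y by auto
    qed
  qed (use W(1) in auto)
  also have "\<dots> \<le> (\<Sum>i. emeasure lborel (W i))"
    using W(1) by (intro emeasure_subadditive_countably) auto
  also have "\<dots> \<le> (\<Sum>i. ennreal (2 * C) * diam_power s (U i))"
    using W(3) by (intro suminf_le) auto
  also have "\<dots> = ennreal (2 * C) * (\<Sum>i. diam_power s (U i))"
    by simp
  also have "\<dots> < ennreal (2 * C) * ennreal (1 / (2 * C))"
    using U(3) \<open>0 < C\<close> by (intro ennreal_mult_strict_left_mono) auto
  also have "\<dots> = 1"
    using \<open>0 < C\<close> by (simp flip: ennreal_mult')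
  finally show False by simp
qed

text \<open>The infimum is approached along \<open>d + e\<close>, so the measure at \<open>d\<close>
  itself may be positive.\<close>

lemma hausdorff_dim_leI:
  assumes "\<And>s. s > d \<Longrightarrow> hausdorff_measure s A = 0" "0 \<le> d"
  shows "hausdorff_dim A \<le> ennreal d"
proof (rule ennreal_le_epsilon)
  fix e :: real assume "e > 0"
  then have "hausdorff_dim A \<le> ennreal (d + e)"
    unfolding hausdorff_dim_def using assms by (intro INF_lower) auto
  then show "hausdorff_dim A \<le> ennreal d + ennreal e"
    using \<open>e > 0\<close> \<open>0 \<le> d\<close> by simp
qed

lemma hausdorff_dim_geI:
  assumes "\<And>s. 0 \<le> s \<Longrightarrow> s < d \<Longrightarrow> hausdorff_measure s A \<noteq> 0"
  shows "ennreal d \<le> hausdorff_dim A"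
  unfolding hausdorff_dim_def using assms by (intro INF_greatest ennreal_leI) force

section \<open>The lacunary group\<close>

lemma infdist_Ints_add:
  "infdist (x + y :: real) \<int> \<le> infdist x \<int> + infdist y \<int>"
proof -
  obtain m where m: "m \<in> \<int>" "infdist x \<int> = dist x m"
    using infdist_attains_inf[of "\<int> :: real set" x] closed_Ints by blast
  obtain n where n: "n \<in> \<int>" "infdist y \<int> = dist y n"
    using infdist_attains_inf[of "\<int> :: real set" y] closed_Ints by blast
  have "infdist (x + y) \<int> \<le> dist (x + y) (m + n)"
    using m n by (intro infdist_le) auto
  also have "\<dots> \<le> dist x m + dist y n"
    by (rule dist_triangle_add)
  finally show ?thesis using m n by simp
qed

lemma infdist_Ints_minus: "infdist (- x :: real) \<int> = infdist x \<int>"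
proof -
  have "infdist (- x) \<int> \<le> infdist x \<int>" for x :: real
  proof -
    obtain m where m: "m \<in> \<int>" "infdist x \<int> = dist x m"
      using infdist_attains_inf[of "\<int> :: real set" x] closed_Ints by blast
    have "infdist (- x) \<int> \<le> dist (- x) (- m)"
      using m by (intro infdist_le) auto
    then show ?thesis using m by (simp add: dist_minus)
  qed
  from this[of x] this[of "- x"] show ?thesis by simp
qed

lemma infdist_Ints_le_iff:
  "infdist (x :: real) \<int> \<le> e \<longleftrightarrow> (\<exists>n::int. \<bar>x - of_int n\<bar> \<le> e)"
proof
  assume *: "infdist x \<int> \<le> e"
  obtain m where "m \<in> \<int>" "infdist x \<int> = dist x m"
    using infdist_attains_inf[of "\<int> :: real set" x] closed_Ints by blast
  then show "\<exists>n::int. \<bar>x - of_int n\<bar> \<le> e"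
    using * by (auto simp: dist_real_def elim!: Ints_cases)
next
  assume "\<exists>n::int. \<bar>x - of_int n\<bar> \<le> e"
  then obtain n :: int where "\<bar>x - of_int n\<bar> \<le> e" by blast
  then show "infdist x \<int> \<le> e"
    by (intro infdist_le2[of "of_int n"]) (auto simp: dist_real_def)
qed

text \<open>The binary digits of an element of \<open>lacunary C\<close> at the positions \<open>k\<^sup>2 + 1, \<dots>, k\<^sup>2 + k\<close>
  are, up to the constant \<open>C\<close> and carries, all \<open>0\<close> or all \<open>1\<close>; those at the
  positions \<open>k\<^sup>2 + k + 1, \<dots>, (k + 1)\<^sup>2\<close> are unrestricted.\<close>

definition lacunary :: "real \<Rightarrow> real set" where
  "lacunary C = {z. \<forall>k. infdist (2 ^ k\<^sup>2 * z) \<int> \<le> C / 2 ^ k}"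

text \<open>The constant is left free because addition adds the constants: a single
  \<open>lacunary C\<close> need not be a subgroup.\<close>

definition lacunary_group :: "real set" where
  "lacunary_group = (\<Union>C. lacunary C)"

lemma lacunary_mono: "C \<le> D \<Longrightarrow> lacunary C \<subseteq> lacunary D"
  unfolding lacunary_def
  by (auto intro: order_trans[OF _ divide_right_mono[of C D]])

lemma closed_lacunary: "closed (lacunary C)"
  unfolding lacunary_def
  by (intro closed_Collect_all closed_Collect_le continuous_intros)

lemma lacunary_add:
  assumes "x \<in> lacunary C" "y \<in> lacunary D"
  shows "x + y \<in> lacunary (C + D)"
  unfolding lacunary_def
proof (intro CollectI allI)
  fix k
  have "infdist (2 ^ k\<^sup>2 * (x + y)) \<int> \<le> infdist (2 ^ k\<^sup>2 * x) \<int> + infdist (2 ^ k\<^sup>2 * y) \<int>"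
    unfolding distrib_left by (rule infdist_Ints_add)
  also have "\<dots> \<le> C / 2 ^ k + D / 2 ^ k"
    using assms by (intro add_mono) (auto simp: lacunary_def)
  finally show "infdist (2 ^ k\<^sup>2 * (x + y)) \<int> \<le> (C + D) / 2 ^ k"
    by (simp add: add_divide_distrib)
qed

lemma lacunary_minus: "x \<in> lacunary C \<Longrightarrow> - x \<in> lacunary C"
  unfolding lacunary_def by (simp add: infdist_Ints_minus)

lemma subgroup_lacunary_group: "subgroup lacunary_group real_add_group"
  unfolding subgroup_real_add_group_iff
proof (intro conjI ballI)
  have "0 \<in> lacunary 0" by (simp add: lacunary_def)
  then show "0 \<in> lacunary_group" by (auto simp: lacunary_group_def)
qed (auto simp: lacunary_group_def intro: lacunary_add lacunary_minus)

text \<open>By monotonicity natural constants suffice, which turns the union into a countable one of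
  closed sets.\<close>

lemma lacunary_group_eq: "lacunary_group = (\<Union>n. lacunary (real n))"
proof
  show "lacunary_group \<subseteq> (\<Union>n. lacunary (real n))"
  proof
    fix x assume "x \<in> lacunary_group"
    then obtain C where C: "x \<in> lacunary C" by (auto simp: lacunary_group_def)
    obtain n where "C \<le> real n" using real_arch_simple by blast
    then show "x \<in> (\<Union>n. lacunary (real n))" using lacunary_mono C by blast
  qed
qed (auto simp: lacunary_group_def)

lemma fsigma_lacunary_group: "fsigma lacunary_group"
  unfolding lacunary_group_eq by (rule fsigma.intros) (rule closed_lacunary)

section \<open>Series with digits at the square positions\<close>

lemma tail_exponent: "k\<^sup>2 + k + 2 * i + (k + 1 + i) \<le> (k + 1 + i)\<^sup>2" for k i :: nat
proof -
  have "i \<le> i * i" by (cases i) auto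
  then have "i \<le> i * i + (i * k + i * k)" by linarith
  then show ?thesis by (simp add: power2_eq_square algebra_simps)
qed

text \<open>For j = k + 1 + i the j-th term is at most D / 2^(j^2 - j), and by
  \<open>tail_exponent\<close> j^2 - j exceeds k^2 + k by at least 2i. A geometric series of ratio
  1/4 thus dominates the tail, whence the factor 4/3.\<close>

lemma digit_series_tail:
  fixes d :: "nat \<Rightarrow> int"
  assumes d: "\<And>j. \<bar>real_of_int (d j)\<bar> \<le> D * 2 ^ j"
  shows "summable (\<lambda>j. d j / 2 ^ j\<^sup>2)"
    and "\<bar>(\<Sum>j. d j / 2 ^ j\<^sup>2) - (\<Sum>j\<le>k. d j / 2 ^ j\<^sup>2)\<bar> \<le> 4 / 3 * D / 2 ^ (k\<^sup>2 + k)"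
proof -
  have "0 \<le> D" using d[of 0] by simp
  have le: "norm (d (i + Suc k) / 2 ^ (i + Suc k)\<^sup>2) \<le> D / 2 ^ (k\<^sup>2 + k) * (1 / 4) ^ i" for i k
  proof -
    have "norm (d (i + Suc k) / 2 ^ (i + Suc k)\<^sup>2) \<le> D * 2 ^ (k + 1 + i) / 2 ^ (k + 1 + i)\<^sup>2"
      using d[of "i + Suc k"] by (simp add: divide_right_mono add.commute)
    also have "\<dots> \<le> D * 2 ^ (k + 1 + i) / 2 ^ (k\<^sup>2 + k + 2 * i + (k + 1 + i))"
      using \<open>0 \<le> D\<close> tail_exponent[of k i] by (intro divide_left_mono power_increasing) auto
    also have "(2::real) ^ (k\<^sup>2 + k + 2 * i + (k + 1 + i)) = 2 ^ (k\<^sup>2 + k) * 4 ^ i * 2 ^ (k + 1 + i)"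
      unfolding power_add[of 2 _ "k + 1 + i"] power_add[of 2 _ "2 * i"] power_mult by simp
    also have "D * 2 ^ (k + 1 + i) / \<dots> = D / 2 ^ (k\<^sup>2 + k) * (1 / 4) ^ i"
      by (simp add: power_divide)
    finally show ?thesis .
  qed
  have geo: "(\<lambda>i. D / 2 ^ (k\<^sup>2 + k) * (1 / 4) ^ i) sums (D / 2 ^ (k\<^sup>2 + k) * (4 / 3))" for k
    using sums_mult[OF geometric_sums[of "1/4::real"], of "D / 2 ^ (k\<^sup>2 + k)"] by simp
  have sm: "summable (\<lambda>i. norm (d (i + Suc k) / 2 ^ (i + Suc k)\<^sup>2))" for k
    by (rule summable_comparison_test[OF _ sums_summable[OF geo[of k]]]) (use le in auto)
  show summ: "summable (\<lambda>j. d j / 2 ^ j\<^sup>2)"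
    using summable_norm_cancel[OF sm[of 0]] summable_iff_shift by blast
  have "(\<Sum>j. d j / 2 ^ j\<^sup>2) - (\<Sum>j\<le>k. d j / 2 ^ j\<^sup>2) = (\<Sum>i. d (i + Suc k) / 2 ^ (i + Suc k)\<^sup>2)"
    using suminf_minus_initial_segment[OF summ, of "Suc k"] by (simp add: lessThan_Suc_atMost)
  also have "norm \<dots> \<le> (\<Sum>i. norm (d (i + Suc k) / 2 ^ (i + Suc k)\<^sup>2))"
    by (rule summable_norm[OF sm])
  also have "\<dots> \<le> D / 2 ^ (k\<^sup>2 + k) * (4 / 3)"
    unfolding sums_unique[OF geo] by (rule suminf_le[OF _ sm sums_summable[OF geo]]) (rule le)
  finally show "\<bar>(\<Sum>j. d j / 2 ^ j\<^sup>2) - (\<Sum>j\<le>k. d j / 2 ^ j\<^sup>2)\<bar> \<le> 4 / 3 * D / 2 ^ (k\<^sup>2 + k)"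
    by (simp add: mult.commute)
qed

lemma digit_partial_sum_Ints:
  fixes d :: "nat \<Rightarrow> int"
  shows "2 ^ k\<^sup>2 * (\<Sum>j\<le>k. d j / 2 ^ j\<^sup>2) \<in> (\<int> :: real set)"
  unfolding sum_distrib_left
proof (rule Ints_sum)
  fix j assume "j \<in> {..k}"
  then have "j\<^sup>2 \<le> k\<^sup>2" by (simp add: power_mono)
  then have "(2::real) ^ k\<^sup>2 = 2 ^ (k\<^sup>2 - j\<^sup>2) * 2 ^ j\<^sup>2"
    by (simp flip: power_add)
  then have "2 ^ k\<^sup>2 * (d j / 2 ^ j\<^sup>2) = real_of_int (2 ^ (k\<^sup>2 - j\<^sup>2) * d j)"
    by simp
  then show "2 ^ k\<^sup>2 * (d j / 2 ^ j\<^sup>2) \<in> (\<int> :: real set)" by (metis Ints_of_int)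
qed

text \<open>Scaling by 2^(k^2) makes the partial sum up to k an integer, while the scaled tail is
  O(2^-k).\<close>

lemma digit_series_in_lacunary:
  fixes d :: "nat \<Rightarrow> int"
  assumes d: "\<And>j. \<bar>real_of_int (d j)\<bar> \<le> D * 2 ^ j"
  shows "(\<Sum>j. d j / 2 ^ j\<^sup>2) \<in> lacunary (4 / 3 * D)"
  unfolding lacunary_def
proof (intro CollectI allI infdist_le2)
  fix k
  let ?S = "\<Sum>j. d j / 2 ^ j\<^sup>2" and ?P = "\<Sum>j\<le>k. d j / 2 ^ j\<^sup>2"
  show "2 ^ k\<^sup>2 * ?P \<in> \<int>" by (rule digit_partial_sum_Ints)
  have "dist (2 ^ k\<^sup>2 * ?S) (2 ^ k\<^sup>2 * ?P) = 2 ^ k\<^sup>2 * \<bar>?S - ?P\<bar>"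
    by (simp add: dist_real_def abs_mult flip: right_diff_distrib)
  also have "\<dots> \<le> 2 ^ k\<^sup>2 * (4 / 3 * D / 2 ^ (k\<^sup>2 + k))"
    using digit_series_tail(2)[OF d] by (intro mult_left_mono) auto
  finally show "dist (2 ^ k\<^sup>2 * ?S) (2 ^ k\<^sup>2 * ?P) \<le> 4 / 3 * D / 2 ^ k"
    by (simp add: power_add)
qed

section \<open>Multiples of the golden ratio modulo 1\<close>

lemma golden_ratio_fib_approx:
  defines "\<phi> \<equiv> (1 + sqrt 5) / 2"
  shows "real (fib n) * \<bar>real (fib n) * \<phi> - real (fib (Suc n))\<bar> \<le> 1"
proof -
  define \<psi> where "\<psi> = (1 - sqrt 5) / 2"
  have [simp]: "sqrt 5 * sqrt 5 = 5" by simp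
  have phi: "\<phi> * \<phi> = \<phi> + 1" and psi: "\<psi> * \<psi> = \<psi> + 1" and pp: "\<phi> * \<psi> = -1" and ps: "\<phi> + \<psi> = 1"
    by (simp_all add: \<phi>_def \<psi>_def field_simps)
  have "1 \<le> \<phi>" by (simp add: \<phi>_def)
  \<comment> \<open>The error is exactly a power of the conjugate root \<open>\<psi>\<close>. As fib
    n is at most \<open>\<phi> ^ n\<close> and \<open>\<phi> * \<psi>\<close> is -1, the product is
    at most 1.\<close>
  have err: "real (fib n) * \<phi> - real (fib (Suc n)) = - (\<psi> ^ n)"
  proof (induction n rule: fib.induct)
    case (3 n)
    have "real (fib (Suc (Suc n))) * \<phi> - real (fib (Suc (Suc (Suc n)))) =
        (real (fib (Suc n)) * \<phi> - real (fib (Suc (Suc n)))) + (real (fib n) * \<phi> - real (fib (Suc n)))"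
      by (simp add: algebra_simps)
    also have "\<dots> = - (\<psi> ^ Suc n) - \<psi> ^ n" using 3 by simp
    also have "\<dots> = - (\<psi> ^ n * (\<psi> * \<psi>))" unfolding psi by (simp add: algebra_simps)
    finally show ?case by simp
  qed (use ps in \<open>auto simp: algebra_simps\<close>)
  have fib_le: "real (fib n) \<le> \<phi> ^ n"
  proof (induction n rule: fib.induct)
    case (3 n)
    then have "real (fib (Suc (Suc n))) \<le> \<phi> ^ n * (\<phi> * \<phi>)"
      unfolding phi by (simp add: algebra_simps)
    then show ?case by (simp add: mult_ac)
  qed (use \<open>1 \<le> \<phi>\<close> in auto)
  have "real (fib n) * \<bar>real (fib n) * \<phi> - real (fib (Suc n))\<bar> = real (fib n) * \<bar>\<psi>\<bar> ^ n"
    by (simp add: err power_abs)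
  also have "\<dots> \<le> \<phi> ^ n * \<bar>\<psi>\<bar> ^ n"
    by (intro mult_right_mono fib_le) auto
  also have "\<dots> = \<bar>\<phi> * \<psi>\<bar> ^ n"
    using \<open>1 \<le> \<phi>\<close> by (simp add: power_mult_distrib abs_mult)
  also have "\<dots> = 1" by (simp add: pp)
  finally show ?thesis .
qed

text \<open>The first Fibonacci number that reaches N is the sum of two smaller than N.\<close>

lemma fib_between:
  assumes "1 \<le> N"
  obtains n where "N \<le> fib n" "fib n \<le> 2 * N"
proof -
  have ge: "n \<le> fib n + 1" for n
  proof (induction n rule: fib.induct)
    case (3 n)
    then show ?case using fib_neq_0_nat[of n] by (cases "n = 0") auto
  qed auto
  define n where "n = (LEAST n. N \<le> fib n)"
  have n: "N \<le> fib n"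
    unfolding n_def by (rule LeastI[of _ "Suc N"]) (use ge[of "Suc N"] in simp)
  have less: "fib m < N" if "m < n" for m
    using not_less_Least[of m "\<lambda>n. N \<le> fib n"] that by (simp add: n_def)
  have "fib n \<le> 2 * N"
    using less[of "n - 1"] less[of "n - 2"] \<open>1 \<le> N\<close> n
    by (cases n rule: fib.cases) auto
  with n show ?thesis using that by blast
qed

text \<open>As \<open>a\<close> runs through a complete residue system modulo the Fibonacci number \<open>q\<close>, so does
  \<open>a * p\<close> for the next Fibonacci number \<open>p\<close>, and \<open>a * \<phi>\<close> is within \<open>1 / q\<close> of \<open>a * p / q\<close>.\<close>

lemma golden_ratio_multiples_dense:
  fixes t :: real
  defines "\<phi> \<equiv> (1 + sqrt 5) / 2"
  shows "\<exists>a::int. 0 \<le> a \<and> a \<le> 2 * (2::int) ^ k \<and> infdist (t - \<phi> * a) \<int> \<le> 2 / 2 ^ k"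
proof -
  obtain n where n: "2 ^ k \<le> fib n" "fib n \<le> 2 * 2 ^ k"
    using fib_between[of "2 ^ k"] by auto
  define p q where "p = int (fib (Suc n))" and "q = int (fib n)"
  have q: "2 ^ k \<le> q" "q \<le> 2 * 2 ^ k"
    using n[THEN of_nat_mono, where 'a = int] by (simp_all add: q_def)
  then have "0 < q" by (smt (verit) zero_less_power)
  have "coprime q p" unfolding p_def q_def by (simp add: coprime_fib_Suc_nat)
  then obtain u where u: "[p * u = 1] (mod q)"
    using cong_solve_coprime_int[of p q] by (auto simp: coprime_commute)
  \<comment> \<open>As p u = 1 modulo q, this a solves p a = m modulo q. So a p / q agrees modulo 1
    with m / q, the largest multiple of 1 / q not above t.\<close>
  define m a where "m = \<lfloor>t * q\<rfloor>" and "a = (m * u) mod q"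
  have "[p * a = p * (m * u)] (mod q)"
    unfolding a_def by (intro cong_mult cong_refl) (simp add: cong_def)
  also have "p * (m * u) = m * (p * u)" by simp
  also have "[m * (p * u) = m * 1] (mod q)" by (intro cong_mult cong_refl u)
  finally have "q dvd m - p * a"
    by (simp add: cong_iff_dvd_diff dvd_diff_commute)
  then obtain r where r: "m - p * a = q * r" by (elim dvdE)
  have a: "0 \<le> a" "a < q" using \<open>0 < q\<close> by (auto simp: a_def)
  \<comment> \<open>One unit comes from rounding \<open>t * q\<close> down, the other from a < q and
    the Fibonacci approximation.\<close>
  have "\<bar>q * (t - \<phi> * a - r)\<bar> \<le> 2"
  proof -
    have "q * (t - \<phi> * a - r) = (t * q - m) - a * (q * \<phi> - p)"
      using arg_cong[OF r, of real_of_int] by (simp add: algebra_simps)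
    moreover have "0 \<le> t * q - m" "t * q - m \<le> 1" by (auto simp: m_def) linarith
    moreover have "\<bar>a * (q * \<phi> - p)\<bar> \<le> 1"
    proof -
      have "\<bar>a * (q * \<phi> - p)\<bar> \<le> q * \<bar>q * \<phi> - p\<bar>"
        using a by (simp add: abs_mult mult_right_mono)
      also have "\<dots> \<le> 1"
        using golden_ratio_fib_approx[of n] by (simp add: p_def q_def \<phi>_def)
      finally show ?thesis .
    qed
    ultimately show ?thesis by linarith
  qed
  then have "q * \<bar>t - \<phi> * a - r\<bar> \<le> 2" using \<open>0 < q\<close> by (simp add: abs_mult)
  then have "\<bar>t - \<phi> * a - r\<bar> \<le> 2 / q" using \<open>0 < q\<close> by (simp add: field_simps)
  also have "\<dots> \<le> 2 / 2 ^ k"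
  proof (rule divide_left_mono)
    show "2 ^ k \<le> real_of_int q" using q(1) by (metis of_int_le_iff of_int_numeral of_int_power)
  qed (use \<open>0 < q\<close> in auto)
  finally have "infdist (t - \<phi> * a) \<int> \<le> 2 / 2 ^ k"
    by (intro infdist_le2[of "of_int r"]) (auto simp: dist_real_def)
  then show ?thesis using a q(2) by (intro exI[of _ a]) auto
qed

text \<open>The digits of \<open>b\<close> are chosen one after the other: the digit with index \<open>k\<close> corrects the \<open>k\<close>-th
  defining condition of \<^const>\<open>lacunary\<close> for \<open>y - \<phi> * b\<close>, and the later ones hardly affect it.\<close>

lemma lacunary_group_sum_golden_ratio:
  defines "\<phi> \<equiv> (1 + sqrt 5) / 2"
  shows "\<exists>a\<in>lacunary_group. \<exists>b\<in>lacunary_group. y = a + \<phi> * b"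
proof -
  \<comment> \<open>Scaled by 2^(k^2), the digit \<open>r\<close> at index k contributes exactly
    \<open>\<phi> * r\<close>. Only digits with smaller index enter through \<open>f\<close>, as the
    choice principle requires.\<close>
  define P where "P f k r \<longleftrightarrow> (0 \<le> r \<and> r \<le> 2 * 2 ^ k \<and>
      infdist (2 ^ k\<^sup>2 * (y - \<phi> * (\<Sum>j<k. of_int (f j) / 2 ^ j\<^sup>2)) - \<phi> * of_int r) \<int> \<le> 2 / 2 ^ k)"
    for f :: "nat \<Rightarrow> int" and k r
  have "\<exists>f. \<forall>k. P f k (f k)"
  proof (rule dependent_wellorder_choice)
    fix r k and f g :: "nat \<Rightarrow> int"
    assume "\<And>j. j < k \<Longrightarrow> f j = g j"
    then have "(\<Sum>j<k. of_int (f j) / 2 ^ j\<^sup>2 :: real) = (\<Sum>j<k. of_int (g j) / 2 ^ j\<^sup>2)"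
      by (intro sum.cong) auto
    then show "P f k r = P g k r" unfolding P_def by simp
  next
    fix k and f :: "nat \<Rightarrow> int"
    show "\<exists>r. P f k r" unfolding P_def \<phi>_def by (rule golden_ratio_multiples_dense)
  qed
  then obtain f where f: "\<And>k. P f k (f k)" by blast
  then have f0: "0 \<le> f k" "f k \<le> 2 * 2 ^ k" for k by (auto simp: P_def)
  have fabs: "\<bar>real_of_int (f k)\<bar> \<le> 2 * 2 ^ k" for k
    using f0(1)[of k] of_int_le_iff[of "f k" "2 * 2 ^ k", where 'a = real] f0(2)[of k] by simp
  define b where "b = (\<Sum>j. f j / 2 ^ j\<^sup>2)"
  have "b \<in> lacunary_group"
    using digit_series_in_lacunary[OF fabs] by (auto simp: lacunary_group_def b_def)
  have "0 \<le> \<phi>" by (simp add: \<phi>_def)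
  \<comment> \<open>The 2 comes from the choice of digit k; 8/3 is the tail constant 4/3 times the
    digit bound D = 2.\<close>
  have "y - \<phi> * b \<in> lacunary (2 + \<phi> * (8 / 3))"
    unfolding lacunary_def
  proof (intro CollectI allI)
    fix k
    let ?S = "\<Sum>j<k. f j / 2 ^ j\<^sup>2" and ?P = "\<Sum>j\<le>k. f j / 2 ^ j\<^sup>2"
    have "infdist (2 ^ k\<^sup>2 * (y - \<phi> * b)) \<int>
        \<le> infdist (2 ^ k\<^sup>2 * (y - \<phi> * ?P)) \<int> + dist (2 ^ k\<^sup>2 * (y - \<phi> * b)) (2 ^ k\<^sup>2 * (y - \<phi> * ?P))"
      by (rule infdist_triangle)
    also have "2 ^ k\<^sup>2 * (y - \<phi> * ?P) = 2 ^ k\<^sup>2 * (y - \<phi> * ?S) - \<phi> * f k"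
      by (simp add: lessThan_Suc_atMost[symmetric] algebra_simps)
    also have "infdist \<dots> \<int> \<le> 2 / 2 ^ k" using f[of k] by (simp add: P_def)
    also have "dist (2 ^ k\<^sup>2 * (y - \<phi> * b)) (2 ^ k\<^sup>2 * (y - \<phi> * ?S) - \<phi> * f k) =
        2 ^ k\<^sup>2 * (\<phi> * \<bar>b - ?P\<bar>)"
    proof -
      have "2 ^ k\<^sup>2 * (y - \<phi> * b) - (2 ^ k\<^sup>2 * (y - \<phi> * ?S) - \<phi> * f k) = - (2 ^ k\<^sup>2 * (\<phi> * (b - ?P)))"
        by (simp add: lessThan_Suc_atMost[symmetric] algebra_simps)
      then show ?thesis using \<open>0 \<le> \<phi>\<close> by (simp add: dist_real_def abs_mult)
    qed
    also have "\<dots> \<le> 2 ^ k\<^sup>2 * (\<phi> * (4 / 3 * 2 / 2 ^ (k\<^sup>2 + k)))"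
      using digit_series_tail(2)[OF fabs] \<open>0 \<le> \<phi>\<close> unfolding b_def by (intro mult_left_mono) auto
    also have "\<dots> = \<phi> * (8 / 3) / 2 ^ k" by (simp add: power_add)
    finally show "infdist (2 ^ k\<^sup>2 * (y - \<phi> * b)) \<int> \<le> (2 + \<phi> * (8 / 3)) / 2 ^ k"
      by (simp add: add_divide_distrib)
  qed
  then have "y - \<phi> * b \<in> lacunary_group" by (auto simp: lacunary_group_def)
  then show ?thesis using \<open>b \<in> lacunary_group\<close> by (intro bexI[of _ "y - \<phi> * b"] bexI[of _ b]) auto
qed

section \<open>The dimension of the lacunary group\<close>

lemma card_ints_in_interval_le:
  fixes c r :: real
  assumes "0 \<le> r"
  shows "finite {m::int. \<bar>m - c\<bar> \<le> r}" "real (card {m::int. \<bar>m - c\<bar> \<le> r}) \<le> 2 * r + 1"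
proof -
  have eq: "{m::int. \<bar>m - c\<bar> \<le> r} = {\<lceil>c - r\<rceil>..\<lfloor>c + r\<rfloor>}"
    by (auto simp: abs_le_iff ceiling_le_iff le_floor_iff)
  show "finite {m::int. \<bar>m - c\<bar> \<le> r}" unfolding eq by simp
  have "real_of_int (\<lfloor>c + r\<rfloor> + 1 - \<lceil>c - r\<rceil>) \<le> 2 * r + 1" by linarith
  then show "real (card {m::int. \<bar>m - c\<bar> \<le> r}) \<le> 2 * r + 1"
    unfolding eq using assms by simp
qed

text \<open>Passing from k to k + 1 scales by 2^(2k+1), but n approximates 2^(k^2) z up to
  \<open>C / 2 ^ k\<close>. So each n in \<open>T k\<close> has at most \<open>7 * C * 2 ^ k\<close>
  successors in \<open>T (Suc k)\<close>, and these factors multiply up.\<close>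

lemma lacunary_approx_card:
  fixes C :: real
  assumes C: "1 \<le> C"
  defines "T \<equiv> \<lambda>k. {n::int. \<exists>z\<in>lacunary C \<inter> {-C..C}. \<bar>2 ^ k\<^sup>2 * z - n\<bar> \<le> C / 2 ^ k}"
  shows "finite (T k) \<and> real (card (T k)) \<le> (7 * C) ^ Suc k * 2 ^ (\<Sum>i<k. i)"
proof (induction k)
  case 0
  \<comment> \<open>For k = 0 both |z| and |z - n| are at most C.\<close>
  define B where "B = {n::int. \<bar>of_int n - 0\<bar> \<le> 2 * C}"
  have sub: "T 0 \<subseteq> B" by (auto simp: T_def B_def)
  have B: "finite B" "real (card B) \<le> 7 * C"
    using card_ints_in_interval_le[of "2 * C" 0] C unfolding B_def by auto
  have "real (card (T 0)) \<le> real (card B)"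
    using card_mono[OF B(1) sub] by simp
  then show ?case using B(2) finite_subset[OF sub B(1)] by simp
next
  case (Suc k)
  \<comment> \<open>The radius allows 2 C 2^k for the scaled error of n and C 2^k for the error of
    m. As C 2^k is at least 1, the count 6 C 2^k + 1 is at most 7 C 2^k.\<close>
  define B where "B n = {m::int. \<bar>m - 2 ^ (2 * k + 1) * real_of_int n\<bar> \<le> 3 * C * 2 ^ k}" for n :: int
  have B: "finite (B n)" "real (card (B n)) \<le> 7 * C * 2 ^ k" for n
  proof -
    have "0 \<le> 3 * C * 2 ^ k" using C by simp
    note * = card_ints_in_interval_le[OF this, of "2 ^ (2 * k + 1) * real_of_int n"]
    show "finite (B n)" unfolding B_def by (rule *)
    have "1 * 1 \<le> C * 2 ^ k" using C by (intro mult_mono) auto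
    then show "real (card (B n)) \<le> 7 * C * 2 ^ k" unfolding B_def using *(2) by linarith
  qed
  have sub: "T (Suc k) \<subseteq> (\<Union>n\<in>T k. B n)"
  proof
    fix m assume "m \<in> T (Suc k)"
    then obtain z where z: "z \<in> lacunary C" "z \<in> {-C..C}"
      and m: "\<bar>2 ^ (Suc k)\<^sup>2 * z - m\<bar> \<le> C / 2 ^ Suc k" by (auto simp: T_def)
    obtain n :: int where n: "\<bar>2 ^ k\<^sup>2 * z - n\<bar> \<le> C / 2 ^ k"
      using z(1) by (auto simp: lacunary_def infdist_Ints_le_iff)
    have "n \<in> T k" using z n by (auto simp: T_def)
    have "(2::real) ^ (Suc k)\<^sup>2 = 2 ^ (2 * k + 1) * 2 ^ k\<^sup>2"
      by (simp add: power2_eq_square power_add[symmetric] algebra_simps del: power_Suc)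
    then have "m - 2 ^ (2 * k + 1) * real_of_int n =
        2 ^ (2 * k + 1) * (2 ^ k\<^sup>2 * z - n) - (2 ^ (Suc k)\<^sup>2 * z - m)"
      by (simp add: right_diff_distrib mult.assoc)
    also have "\<bar>\<dots>\<bar> \<le> 2 ^ (2 * k + 1) * \<bar>2 ^ k\<^sup>2 * z - n\<bar> + \<bar>2 ^ (Suc k)\<^sup>2 * z - m\<bar>"
      by (rule order_trans[OF abs_triangle_ineq4]) (simp add: abs_mult)
    also have "\<dots> \<le> 2 ^ (2 * k + 1) * (C / 2 ^ k) + C / 2 ^ Suc k"
      using m n by (intro add_mono mult_left_mono) auto
    also have "2 ^ (2 * k + 1) * (C / 2 ^ k) = 2 * C * 2 ^ k"
    proof -
      have "(2::real) ^ (2 * k + 1) = 2 * (2 ^ k * 2 ^ k)"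
        unfolding mult_2 power_add power_one_right by simp
      then show ?thesis by simp
    qed
    also have "C / 2 ^ Suc k \<le> C * 2 ^ k"
    proof -
      have "C / 2 ^ Suc k \<le> C / 1" using C one_le_power[of "2::real" "Suc k"] by (intro divide_left_mono) auto
      also have "\<dots> \<le> C * 2 ^ k" using C by simp
      finally show ?thesis .
    qed
    finally have "m \<in> B n" by (simp add: B_def)
    then show "m \<in> (\<Union>n\<in>T k. B n)" using \<open>n \<in> T k\<close> by blast
  qed
  have fin: "finite (\<Union>n\<in>T k. B n)" using Suc B by blast
  have "real (card (T (Suc k))) \<le> real (card (\<Union>n\<in>T k. B n))"
    using card_mono[OF fin sub] by simp
  also have "\<dots> \<le> real (\<Sum>n\<in>T k. card (B n))"
    using Suc by (intro of_nat_mono card_UN_le) auto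
  also have "\<dots> \<le> real (card (T k)) * (7 * C * 2 ^ k)"
    unfolding of_nat_sum using B by (intro sum_bounded_above) auto
  also have "\<dots> \<le> (7 * C) ^ Suc k * 2 ^ (\<Sum>i<k. i) * (7 * C * 2 ^ k)"
    using Suc C by (intro mult_right_mono) auto
  also have "\<dots> = (7 * C) ^ Suc (Suc k) * 2 ^ (\<Sum>i<Suc k. i)"
    by (simp add: power_add)
  finally show ?case using finite_subset[OF sub fin] by (intro conjI)
qed

lemma two_sum_lessThan: "2 * (\<Sum>i<k. real i) = real k * (real k - 1)"
  by (induction k) (auto simp: algebra_simps)

text \<open>In base 2 the exponent is k^2/2 - s k^2 plus linear terms, and s > 1/2 makes the
  quadratic part negative.\<close>

lemma cover_sum_tendsto_0:
  fixes C s :: real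
  assumes C: "1 \<le> C" and s: "1 / 2 < s"
  shows "(\<lambda>k. (7 * C) ^ Suc k * 2 ^ (\<Sum>i<k. i) * (2 * C / 2 ^ (k\<^sup>2 + k)) powr s) \<longlonglongrightarrow> 0"
proof -
  define \<epsilon> where "\<epsilon> = s - 1 / 2"
  have "\<epsilon> > 0" using s by (simp add: \<epsilon>_def)
  have "(7 * C) ^ Suc k * 2 ^ (\<Sum>i<k. i) * (2 * C / 2 ^ (k\<^sup>2 + k)) powr s =
      (2 * C) powr s * (7 * C) * exp (real k * (ln (7 * C) - ln 2 * (1 / 2 + s) - ln 2 * \<epsilon> * real k))" for k
  proof -
    have e1: "(7 * C) ^ Suc k = 7 * C * exp (real k * ln (7 * C))"
      using C by (simp add: exp_of_nat_mult)
    have e2: "(2::real) ^ (\<Sum>i<k. i) = exp (ln 2 * (real k * (real k - 1) / 2))"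
      using two_sum_lessThan[of k]
      by (simp add: powr_realpow[symmetric] powr_def mult.commute)
    have e3: "(2 * C / 2 ^ (k\<^sup>2 + k)) powr s = (2 * C) powr s * exp (- (ln 2 * s * (real k * real k + real k)))"
    proof -
      have "(2::real) ^ (k\<^sup>2 + k) = exp (ln 2 * (real k * real k + real k))"
        by (simp add: powr_realpow[symmetric] powr_def mult.commute power2_eq_square del: powr_realpow)
      then have "2 * C / 2 ^ (k\<^sup>2 + k) = 2 * C * exp (- (ln 2 * (real k * real k + real k)))"
        by (simp only: exp_minus divide_inverse)
      then show ?thesis
        using C by (simp only: powr_mult exp_powr_real) (simp add: algebra_simps)
    qed
    have e4: "real k * (ln (7 * C) - ln 2 * (1 / 2 + s) - ln 2 * \<epsilon> * real k) =
        real k * ln (7 * C) + ln 2 * (real k * (real k - 1) / 2) + - (ln 2 * s * (real k * real k + real k))"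
      by (simp add: \<epsilon>_def field_simps)
    show ?thesis unfolding e1 e2 e3 e4 exp_add by (simp only: mult_ac)
  qed
  moreover have "(\<lambda>k. (2 * C) powr s * (7 * C) *
      exp (real k * (ln (7 * C) - ln 2 * (1 / 2 + s) - ln 2 * \<epsilon> * real k))) \<longlonglongrightarrow> 0"
    using \<open>\<epsilon> > 0\<close> by real_asymp
  ultimately show ?thesis by (simp only:)
qed

text \<open>Every integer counted in \<open>lacunary_approx_card\<close> gives an interval of radius
  C / 2^(k^2 + k); their Hausdorff sum is bounded by the sequence of
  \<open>cover_sum_tendsto_0\<close>.\<close>

lemma hausdorff_measure_lacunary_bounded:
  assumes C: "1 \<le> C" and s: "1 / 2 < s"
  shows "hausdorff_measure s (lacunary C \<inter> {-C..C}) = 0"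
proof (rule hausdorff_measure_eq_0I)
  fix \<delta> e :: real assume "\<delta> > 0" "e > 0"
  let ?E = "lacunary C \<inter> {-C..C}"
  have "(\<lambda>k. 2 * C / 2 ^ (k\<^sup>2 + k)) \<longlonglongrightarrow> 0" by real_asymp
  then have "\<forall>\<^sub>F k in sequentially. 2 * C / 2 ^ (k\<^sup>2 + k) < \<delta>"
    using \<open>\<delta> > 0\<close> by (rule order_tendstoD)
  moreover have "\<forall>\<^sub>F k in sequentially.
      (7 * C) ^ Suc k * 2 ^ (\<Sum>i<k. i) * (2 * C / 2 ^ (k\<^sup>2 + k)) powr s < e"
    using cover_sum_tendsto_0[OF C s] \<open>e > 0\<close> by (rule order_tendstoD)
  ultimately have "\<forall>\<^sub>F k in sequentially. 2 * C / 2 ^ (k\<^sup>2 + k) < \<delta> \<and>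
      (7 * C) ^ Suc k * 2 ^ (\<Sum>i<k. i) * (2 * C / 2 ^ (k\<^sup>2 + k)) powr s < e"
    by (rule eventually_conj)
  then obtain k where k: "2 * C / 2 ^ (k\<^sup>2 + k) < \<delta>"
      "(7 * C) ^ Suc k * 2 ^ (\<Sum>i<k. i) * (2 * C / 2 ^ (k\<^sup>2 + k)) powr s < e"
    by (auto simp: eventually_sequentially)
  define T where "T = {n::int. \<exists>z\<in>?E. \<bar>2 ^ k\<^sup>2 * z - n\<bar> \<le> C / 2 ^ k}"
  define d where "d = C / 2 ^ (k\<^sup>2 + k)"
  have "0 \<le> d" using C by (simp add: d_def)
  have T: "finite T" "real (card T) \<le> (7 * C) ^ Suc k * 2 ^ (\<Sum>i<k. i)"
    using lacunary_approx_card[OF C, of k] by (auto simp: T_def)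
  have "?E \<subseteq> (\<Union>n\<in>T. cball (n / 2 ^ k\<^sup>2) d)"
  proof
    fix z assume z: "z \<in> ?E"
    then obtain n :: int where n: "\<bar>2 ^ k\<^sup>2 * z - n\<bar> \<le> C / 2 ^ k"
      by (auto simp: lacunary_def infdist_Ints_le_iff)
    then have "n \<in> T" using z by (auto simp: T_def)
    have "n / 2 ^ k\<^sup>2 - z = - ((2 ^ k\<^sup>2 * z - n) / 2 ^ k\<^sup>2)" by (simp add: field_simps)
    then have "dist (n / 2 ^ k\<^sup>2) z = \<bar>2 ^ k\<^sup>2 * z - n\<bar> / 2 ^ k\<^sup>2"
      by (simp only: dist_real_def abs_minus_cancel abs_divide) simp
    also have "\<dots> \<le> C / 2 ^ k / 2 ^ k\<^sup>2" using n by (intro divide_right_mono) auto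
    also have "\<dots> = d" by (simp add: d_def power_add)
    finally show "z \<in> (\<Union>n\<in>T. cball (n / 2 ^ k\<^sup>2) d)" using \<open>n \<in> T\<close> by auto
  qed
  then have "hausdorff_premeasure s \<delta> ?E \<le> ennreal (of_nat (card T) * (2 * d) powr s)"
  proof (intro hausdorff_premeasure_le_finite_cover[OF T(1)])
    show "2 * d \<le> \<delta>" using k by (simp add: d_def)
  qed (use s \<open>0 \<le> d\<close> in auto)
  also have "\<dots> \<le> ennreal e"
  proof (rule ennreal_leI)
    have "real (card T) * (2 * d) powr s \<le>
        (7 * C) ^ Suc k * 2 ^ (\<Sum>i<k. i) * (2 * C / 2 ^ (k\<^sup>2 + k)) powr s"
      using mult_right_mono[OF T(2), of "(2 * d) powr s"] by (simp add: d_def)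
    then show "real (card T) * (2 * d) powr s \<le> e" using k(2) by linarith
  qed
  finally show "hausdorff_premeasure s \<delta> ?E \<le> ennreal e" .
qed

lemma hausdorff_measure_lacunary_group_eq_0:
  assumes "1 / 2 < s"
  shows "hausdorff_measure s lacunary_group = 0"
proof -
  \<comment> \<open>\<open>Suc n\<close> keeps the constant at least 1; the same constant bounds the
    size of the elements.\<close>
  have "lacunary_group \<subseteq> (\<Union>n. lacunary (real (Suc n)) \<inter> {- real (Suc n)..real (Suc n)})"
  proof
    fix z assume "z \<in> lacunary_group"
    then obtain C where C: "z \<in> lacunary C" by (auto simp: lacunary_group_def)
    obtain n where "max C \<bar>z\<bar> \<le> real n" using real_arch_simple by blast
    then have "z \<in> lacunary (real (Suc n))" "z \<in> {- real (Suc n)..real (Suc n)}"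
      using C lacunary_mono[of C "real (Suc n)"] by (auto simp: abs_le_iff)
    then show "z \<in> (\<Union>n. lacunary (real (Suc n)) \<inter> {- real (Suc n)..real (Suc n)})" by blast
  qed
  then have "hausdorff_measure s lacunary_group \<le>
      hausdorff_measure s (\<Union>n. lacunary (real (Suc n)) \<inter> {- real (Suc n)..real (Suc n)})"
    by (rule hausdorff_measure_mono)
  also have "\<dots> = 0"
    using assms by (intro hausdorff_measure_UN_eq_0 hausdorff_measure_lacunary_bounded) auto
  finally show ?thesis by simp
qed

section \<open>Lower bound for the dimension\<close>

text \<open>The lower bound on the dimension comes from moving the \<open>k\<close>-th block of \<open>k\<close> consecutive binary
  digits of \<open>y\<close> to the last \<open>k\<close> positions up to \<open>k\<^sup>2\<close>.\<close>

definition block_digit :: "real \<Rightarrow> nat \<Rightarrow> int" where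
  "block_digit y j = (case j of 0 \<Rightarrow> 0
     | Suc k \<Rightarrow> \<lfloor>2 ^ (\<Sum>i\<le>Suc k. i) * y\<rfloor> - 2 ^ Suc k * \<lfloor>2 ^ (\<Sum>i\<le>k. i) * y\<rfloor>)"

definition spread_blocks :: "real \<Rightarrow> real" where
  "spread_blocks y = (\<Sum>j. block_digit y j / 2 ^ j\<^sup>2)"

lemma block_digit_bounds: "0 \<le> block_digit y j" "block_digit y j \<le> 2 ^ j"
proof -
  have "0 \<le> \<lfloor>2 ^ m * u\<rfloor> - 2 ^ m * \<lfloor>u\<rfloor> \<and> \<lfloor>2 ^ m * u\<rfloor> - 2 ^ m * \<lfloor>u\<rfloor> \<le> 2 ^ m" for m and u :: real
  proof -
    have "2 ^ m * real_of_int \<lfloor>u\<rfloor> \<le> 2 ^ m * u"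
      by (intro mult_left_mono) auto
    moreover have "u \<le> real_of_int \<lfloor>u\<rfloor> + 1" by linarith
    then have "2 ^ m * u \<le> 2 ^ m * (real_of_int \<lfloor>u\<rfloor> + 1)"
      by (intro mult_left_mono) auto
    ultimately show ?thesis
      by (auto simp: le_floor_iff floor_le_iff algebra_simps)
  qed
  from this[of "j" "2 ^ (\<Sum>i\<le>j - 1. i) * y"]
  show "0 \<le> block_digit y j" "block_digit y j \<le> 2 ^ j"
    by (auto simp: block_digit_def power_add mult_ac split: nat.split)
qed

lemma block_digit_abs_le: "\<bar>real_of_int (block_digit y j)\<bar> \<le> 1 * 2 ^ j"
  using block_digit_bounds[of y j] of_int_le_iff[of "block_digit y j" "2 ^ j", where 'a = real] by simp

lemma two_sum_atMost: "2 * (\<Sum>i\<le>k. real i) = real k * (real k + 1)"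
  by (induction k) (auto simp: algebra_simps)

text \<open>Block m + 1 is the first in which y and z differ. Agreement before it bounds |y - z|.
  The difference there contributes at least w = 2^(-(m+1)^2) to the image, of which later blocks
  cancel at most 2/3.\<close>

lemma spread_blocks_separation:
  assumes "0 \<le> y" "y < 1" "0 \<le> z" "z < 1" "y \<noteq> z"
  obtains m where "\<bar>y - z\<bar> \<le> 1 / 2 ^ (\<Sum>i\<le>m. i)"
    "1 / 2 ^ ((Suc m)\<^sup>2 + 2) \<le> \<bar>spread_blocks y - spread_blocks z\<bar>"
proof -
  let ?F = "\<lambda>x k. \<lfloor>2 ^ (\<Sum>i\<le>k. i) * x\<rfloor>"
  have "\<exists>k. ?F y k \<noteq> ?F z k"
  proof -
    obtain k where "1 / \<bar>y - z\<bar> < 2 ^ k"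
      using real_arch_pow[of 2] by auto
    also have "(2::real) ^ k \<le> 2 ^ (\<Sum>i\<le>k. i)"
      by (intro power_increasing member_le_sum) auto
    finally have "1 < 2 ^ (\<Sum>i\<le>k. i) * \<bar>y - z\<bar>"
      using \<open>y \<noteq> z\<close> by (simp add: field_simps)
    also have "\<dots> = \<bar>2 ^ (\<Sum>i\<le>k. i) * y - 2 ^ (\<Sum>i\<le>k. i) * z\<bar>"
      by (simp add: abs_mult flip: right_diff_distrib)
    finally have "?F y k \<noteq> ?F z k" by linarith
    then show ?thesis by blast
  qed
  then obtain k where k: "?F y k \<noteq> ?F z k" "\<And>j. j < k \<Longrightarrow> ?F y j = ?F z j"
    using exists_least_iff[of "\<lambda>k. ?F y k \<noteq> ?F z k"] by blast
  have "\<lfloor>y\<rfloor> = 0" "\<lfloor>z\<rfloor> = 0" using assms by (simp_all add: floor_eq_iff)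
  \<comment> \<open>The empty prefix only sees the integer parts, which vanish on [0,1).\<close>
  then have "k \<noteq> 0" using k(1) by (intro notI) simp
  then obtain m where m: "k = Suc m" by (cases k) auto
  have "?F y m = ?F z m" using k(2) m by simp
  then have "\<bar>2 ^ (\<Sum>i\<le>m. i) * y - 2 ^ (\<Sum>i\<le>m. i) * z\<bar> \<le> 1" by linarith
  then have "2 ^ (\<Sum>i\<le>m. i) * \<bar>y - z\<bar> \<le> 1"
    by (simp add: abs_mult flip: right_diff_distrib)
  then have 1: "\<bar>y - z\<bar> \<le> 1 / 2 ^ (\<Sum>i\<le>m. i)" by (simp add: field_simps)
  define d where "d j = block_digit y j - block_digit z j" for j
  have d0: "d j = 0" if "j \<le> m" for j
    using k(2) that m by (auto simp: d_def block_digit_def simp del: sum.atMost_Suc split: nat.split)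
  have "d (Suc m) \<noteq> 0"
    using k m by (simp add: d_def block_digit_def del: sum.atMost_Suc)
  then have d1: "1 \<le> \<bar>real_of_int (d (Suc m))\<bar>" by linarith
  \<comment> \<open>Both digits lie between 0 and 2^j, so the difference has constant 1. With
    constant 2 the tail estimate could exceed w.\<close>
  have dle: "\<bar>real_of_int (d j)\<bar> \<le> 1 * 2 ^ j" for j
  proof -
    have "\<bar>d j\<bar> \<le> 2 ^ j"
      using block_digit_bounds[of y j] block_digit_bounds[of z j] by (simp add: d_def abs_le_iff)
    then show ?thesis using of_int_le_iff[of "\<bar>d j\<bar>" "2 ^ j", where 'a = real] by simp
  qed
  define w :: real where "w = 1 / 2 ^ (Suc m)\<^sup>2"
  have "0 < w" by (simp add: w_def)
  have "spread_blocks y - spread_blocks z = (\<Sum>j. d j / 2 ^ j\<^sup>2)"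
    using suminf_diff[OF digit_series_tail(1)[OF block_digit_abs_le[of y]]
        digit_series_tail(1)[OF block_digit_abs_le[of z]]]
    by (simp add: spread_blocks_def d_def diff_divide_distrib)
  moreover have "(\<Sum>j\<le>Suc m. d j / 2 ^ j\<^sup>2) = d (Suc m) * w"
    using d0 by (simp add: w_def)
  moreover have "4 / 3 * 1 / 2 ^ ((Suc m)\<^sup>2 + Suc m) \<le> 2 / 3 * w"
  proof -
    have "(2::real) ^ 1 \<le> 2 ^ Suc m" by (intro power_increasing) auto
    then have "4 / 3 / 2 ^ Suc m * w \<le> 4 / 3 / 2 ^ 1 * w"
      using \<open>0 < w\<close> by (intro mult_right_mono divide_left_mono) auto
    then show ?thesis unfolding power_add w_def by simp
  qed
  ultimately have "\<bar>(spread_blocks y - spread_blocks z) - d (Suc m) * w\<bar> \<le> 2 / 3 * w"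
    using order_trans[OF digit_series_tail(2)[OF dle, of "Suc m"]] by (simp only:)
  moreover have "w \<le> \<bar>d (Suc m) * w\<bar>"
    using d1 \<open>0 < w\<close> by (simp add: abs_mult)
  ultimately have "1 / 4 * w \<le> \<bar>spread_blocks y - spread_blocks z\<bar>"
    using \<open>0 < w\<close> by linarith
  then have "1 / 2 ^ ((Suc m)\<^sup>2 + 2) \<le> \<bar>spread_blocks y - spread_blocks z\<bar>"
    unfolding w_def power_add by simp
  with 1 show ?thesis by (rule that)
qed

text \<open>\<open>spread_blocks\<close> is expanding: |y - z| is about 2^(-m^2/2) at most, the
  images differ by about 2^(-m^2) at least, and s < 1/2 absorbs the linear terms of the exponents
  into C.\<close>

lemma hausdorff_measure_lacunary_group_ne_0:
  assumes s: "0 \<le> s" "s < 1 / 2"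
  shows "hausdorff_measure s lacunary_group \<noteq> 0"
proof (rule hausdorff_measure_ne_0_if_expanding)
  show "spread_blocks y \<in> lacunary_group" for y
    using digit_series_in_lacunary[OF block_digit_abs_le[of y]]
    by (auto simp: lacunary_group_def spread_blocks_def)
  define \<epsilon> where "\<epsilon> = 1 / 2 - s"
  have "\<epsilon> > 0" using s by (simp add: \<epsilon>_def)
  \<comment> \<open>The exponent deficit is m/2 + 3/2 - \<epsilon> (m^2 + 2m + 3), and m/2 -
    \<epsilon> m^2 is at most 1/(16 \<epsilon>) by completing the square.\<close>
  define C :: real where "C = 2 powr (3 / 2 + 1 / (16 * \<epsilon>))"
  show "0 < C" by (simp add: C_def)
  fix y z :: real assume yz: "0 \<le> y" "y < 1" "0 \<le> z" "z < 1"
  show "\<bar>y - z\<bar> \<le> C * dist (spread_blocks y) (spread_blocks z) powr s"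
  proof (cases "y = z")
    case False
    obtain m where m: "\<bar>y - z\<bar> \<le> 1 / 2 ^ (\<Sum>i\<le>m. i)"
        "1 / 2 ^ ((Suc m)\<^sup>2 + 2) \<le> \<bar>spread_blocks y - spread_blocks z\<bar>"
      using spread_blocks_separation[OF yz False] .
    have "0 \<le> (\<epsilon> * m - 1 / 4)\<^sup>2 / \<epsilon>" using \<open>\<epsilon> > 0\<close> by simp
    also have "\<dots> = \<epsilon> * m * m - m / 2 + 1 / (16 * \<epsilon>)"
      using \<open>\<epsilon> > 0\<close> by (simp add: power2_eq_square field_simps)
    finally have quad: "m / 2 \<le> \<epsilon> * m * m + 1 / (16 * \<epsilon>)" by simp
    have "0 \<le> \<epsilon> * (2 * m + 3)" using \<open>\<epsilon> > 0\<close> by simp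
    then have exponent: "- (m * (m + 1) / 2) \<le> 3 / 2 + 1 / (16 * \<epsilon>) - s * ((real (Suc m))\<^sup>2 + 2)"
      using quad by (simp add: \<epsilon>_def power2_eq_square algebra_simps add_divide_distrib)
    have two_power: "1 / 2 ^ n = (2::real) powr - real n" for n
      by (simp add: powr_minus_divide powr_realpow)
    have tri: "real (\<Sum>i\<le>m. i) = m * (m + 1) / 2"
      using two_sum_atMost[of m] by (simp add: algebra_simps)
    have "\<bar>y - z\<bar> \<le> 2 powr - (m * (m + 1) / 2)"
      using m(1) unfolding two_power tri .
    also have "\<dots> \<le> 2 powr (3 / 2 + 1 / (16 * \<epsilon>) - s * ((real (Suc m))\<^sup>2 + 2))"
      using exponent by (intro powr_mono) auto
    also have "\<dots> = C * (1 / 2 ^ ((Suc m)\<^sup>2 + 2)) powr s"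
      unfolding C_def two_power powr_powr powr_add[symmetric] by (simp add: algebra_simps)
    also have "\<dots> \<le> C * \<bar>spread_blocks y - spread_blocks z\<bar> powr s"
      using m(2) s \<open>0 < C\<close> by (intro mult_left_mono powr_mono2) auto
    finally show ?thesis by (simp add: dist_real_def)
  qed simp
qed (use s in auto)

lemma hausdorff_dim_lacunary_group: "hausdorff_dim lacunary_group = 1 / 2"
proof -
  have "hausdorff_dim lacunary_group = ennreal (1 / 2)"
    using hausdorff_measure_lacunary_group_eq_0 hausdorff_measure_lacunary_group_ne_0
    by (intro antisym hausdorff_dim_leI hausdorff_dim_geI) auto
  then show ?thesis by (simp add: divide_ennreal_def)
qed

section \<open>A generic group under the continuum hypothesis\<close>

lemma powr_of_power: "0 < x \<Longrightarrow> (x ^ n) powr s = (x powr s) ^ n" for x s :: real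
  by (induction n) (auto simp: powr_mult)

text \<open>The balls around the enumerated rationals shrink geometrically. Each \<open>U n\<close>
  covers the intersection, and its s-sum is a geometric series that tends to 0 with n for every s >
  0.\<close>

lemma dense_open_null_sets:
  obtains U :: "nat \<Rightarrow> real set" where "\<And>n. open (U n)" "\<And>n. closure (U n) = UNIV" "\<And>n. 0 \<in> U n"
    "\<And>s. 0 < s \<Longrightarrow> hausdorff_measure s (\<Inter>n. U n) = 0"
proof
  define q :: "nat \<Rightarrow> real" where "q = from_nat_into \<rat>"
  have q: "range q = \<rat>"
    unfolding q_def by (rule range_from_nat_into) (auto intro: countable_rat Rats_0)
  define r :: "nat \<Rightarrow> nat \<Rightarrow> real" where "r n i = (1 / 2 ^ Suc n) ^ Suc i" for n i
  have r: "0 < r n i" for n i by (simp add: r_def)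
  define U where "U n = (\<Union>i. ball (q i) (r n i / 2))" for n
  show "open (U n)" for n by (simp add: U_def open_UN)
  have rats: "\<rat> \<subseteq> U n" for n
  proof
    fix x :: real assume "x \<in> \<rat>"
    then obtain i where "x = q i" using q by auto
    then have "x \<in> ball (q i) (r n i / 2)" using r by simp
    then show "x \<in> U n" unfolding U_def by blast
  qed
  then show "0 \<in> U n" for n by (auto intro: Rats_0)
  show "closure (U n) = UNIV" for n
    using closure_mono[OF rats[of n]] Rats_closure_real by auto
  fix s :: real assume s: "0 < s"
  show "hausdorff_measure s (\<Inter>n. U n) = 0"
  proof (rule hausdorff_measure_eq_0I)
    fix \<delta> e :: real assume "\<delta> > 0" "e > 0"
    define t where "t n = (1 / 2 ^ Suc n :: real) powr s" for n
    have "t \<longlonglongrightarrow> 0" unfolding t_def using s by real_asymp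
    \<comment> \<open>The bound 1/2 makes 1 / (1 - t n) at most 2, so the whole series stays below
      e.\<close>
    then have "\<forall>\<^sub>F n in sequentially. t n < min (1 / 2) (e / 2)"
      using \<open>e > 0\<close> by (intro order_tendstoD) auto
    moreover have "(\<lambda>n. 1 / 2 ^ Suc n :: real) \<longlonglongrightarrow> 0" by real_asymp
    then have "\<forall>\<^sub>F n in sequentially. (1 / 2 ^ Suc n :: real) < \<delta>"
      using \<open>\<delta> > 0\<close> by (rule order_tendstoD)
    ultimately have "\<forall>\<^sub>F n in sequentially. t n < min (1 / 2) (e / 2) \<and> (1 / 2 ^ Suc n :: real) < \<delta>"
      by (rule eventually_conj)
    then obtain n where n: "t n < 1 / 2" "t n < e / 2" "(1 / 2 ^ Suc n :: real) < \<delta>"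
      by (auto simp: eventually_sequentially)
    have "0 \<le> t n" by (simp add: t_def)
    have diam: "diameter (ball (q i) (r n i / 2)) = r n i" for i
      using r[of n i] by (simp add: diameter_ball)
    have "r n i \<le> \<delta>" for i
    proof -
      have "r n i \<le> (1 / 2 ^ Suc n) ^ 1"
        unfolding r_def using one_le_power[of "2::real" "Suc n"] by (intro power_decreasing) auto
      then show ?thesis using n(3) by simp
    qed
    then have "hausdorff_premeasure s \<delta> (\<Inter>n. U n) \<le> (\<Sum>i. diam_power s (ball (q i) (r n i / 2)))"
      by (intro hausdorff_premeasure_le) (auto simp: U_def diam simp del: diameter_ball)
    also have "\<dots> = (\<Sum>i. ennreal (t n * t n ^ i))"
    proof (rule suminf_cong)
      fix i
      have "r n i powr s = t n ^ Suc i"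
        unfolding r_def t_def by (rule powr_of_power) simp
      then show "diam_power s (ball (q i) (r n i / 2)) = ennreal (t n * t n ^ i)"
        using r[of n i] s by (simp add: diam_power_def diam del: diameter_ball)
    qed
    also have "\<dots> = ennreal (t n * (1 / (1 - t n)))"
      using n(1) \<open>0 \<le> t n\<close>
      by (intro suminf_ennreal_eq sums_mult geometric_sums) auto
    also have "\<dots> \<le> ennreal e"
    proof (rule ennreal_leI)
      have "t n * (1 / (1 - t n)) \<le> t n * 2"
        using n(1) \<open>0 \<le> t n\<close> by (intro mult_left_mono) (auto simp: field_simps)
      then show "t n * (1 / (1 - t n)) \<le> e" using n(2) by linarith
    qed
    finally show "hausdorff_premeasure s \<delta> (\<Inter>n. U n) \<le> ennreal e" .
  qed
qed

section \<open>Well-ordering the pairs of reals\<close>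

context
  includes cardinal_syntax
begin

text \<open>A pair is determined by the rational lower cuts of its components, which the boolean tag
  joins into one countable set.\<close>

lemma card_real_prod_le_continuum: "|UNIV :: (real \<times> real) set| \<le>o ctwo ^c natLeq"
proof -
  define F :: "real \<times> real \<Rightarrow> nat set"
    where "F p = to_nat ` {(b :: bool, q :: rat). of_rat q < (if b then fst p else snd p)}" for p
  have "inj F"
  proof (rule injI)
    fix p p' assume "F p = F p'"
    then have eq: "{(b :: bool, q :: rat). of_rat q < (if b then fst p else snd p)} =
        {(b, q). of_rat q < (if b then fst p' else snd p')}"
      unfolding F_def by (simp add: inj_image_eq_iff)
    have cut: "x = x'" if "\<And>q :: rat. of_rat q < x \<longleftrightarrow> of_rat q < x'" for x x' :: real
      using that of_rat_dense[of x x'] of_rat_dense[of x' x] by (metis less_asym linorder_neqE)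
    have "of_rat q < fst p \<longleftrightarrow> of_rat q < fst p'" "of_rat q < snd p \<longleftrightarrow> of_rat q < snd p'" for q :: rat
      using eq[unfolded set_eq_iff, rule_format, of "(True, q)"]
        eq[unfolded set_eq_iff, rule_format, of "(False, q)"] by auto
    then show "p = p'" by (intro prod_eqI cut)
  qed
  then have "|UNIV :: (real \<times> real) set| \<le>o |UNIV :: nat set set|"
    by (intro card_of_ordLeqI[of F]) auto
  also have "|UNIV :: nat set set| =o ctwo ^c |UNIV :: nat set|"
    using card_of_Pow_Func[of "UNIV :: nat set"] by (simp only: cexp_def ctwo_def Field_card_of Pow_UNIV)
  also have "ctwo ^c |UNIV :: nat set| =o ctwo ^c natLeq"
    unfolding ctwo_def by (intro cexp_cong2 card_of_nat card_of_Card_order)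
  finally show ?thesis .
qed

text \<open>The order is the strict part of a cardinal order. Its initial segments are smaller than
  the continuum, which is the successor of aleph_0, hence countable.\<close>

lemma continuum_hypothesis_wellorder:
  assumes continuum_hypothesis
  obtains R :: "(real \<times> real) rel"
  where "wf R" "trans R" "\<And>p q. (p, q) \<in> R \<or> p = q \<or> (q, p) \<in> R" "\<And>p. countable {q. (q, p) \<in> R}"
proof
  define r where "r = |UNIV :: (real \<times> real) set|"
  have "Field r = UNIV" by (simp add: r_def Field_card_of)
  have "Card_order r" unfolding r_def by (rule card_of_Card_order)
  have "Well_order r" unfolding r_def by (rule card_of_Well_order)
  then have lin: "linear_order r" and wf: "wf (r - Id)"
    by (simp_all add: well_order_on_def \<open>Field r = UNIV\<close>)
  show "wf (r - Id)" by (rule wf)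
  show "trans (r - Id)"
    using lin by (intro trans_diff_Id) (auto simp: order_on_defs)
  show "(p, q) \<in> r - Id \<or> p = q \<or> (q, p) \<in> r - Id" for p q
  proof -
    have "total r" using lin by (simp add: order_on_defs)
    then show ?thesis unfolding total_on_def by blast
  qed
  show "countable {q. (q, p) \<in> r - Id}" for p
  proof -
    have "|underS r p| <o r"
      using \<open>Card_order r\<close> \<open>Field r = UNIV\<close> by (intro card_of_underS) auto
    also have "r \<le>o ctwo ^c natLeq" unfolding r_def by (rule card_real_prod_le_continuum)
    also have "ctwo ^c natLeq =o cardSuc natLeq"
      using assms by (simp add: continuum_hypothesis_def)
    finally have "|underS r p| \<le>o natLeq"
      by (simp add: cardSuc_ordLeq_ordLess natLeq_Card_order card_of_Card_order)
    moreover have "{q. (q, p) \<in> r - Id} = underS r p" by (auto simp: underS_def)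
    ultimately show ?thesis by (simp add: countable_card_le_natLeq)
  qed
qed

end

section \<open>Generic choices by Baire category\<close>

lemma dense_affine_vimage:
  fixes U :: "real set"
  assumes "open U" "closure U = UNIV" "c \<noteq> 0"
  shows "open {b. a + c * b \<in> U}" "closure {b. a + c * b \<in> U} = UNIV"
proof -
  have "open ((\<lambda>b. a + c * b) -` U)"
    using \<open>open U\<close> by (intro open_vimage continuous_intros)
  then show "open {b. a + c * b \<in> U}" by (simp add: vimage_def)
  have "b \<in> closure {b. a + c * b \<in> U}" for b
    unfolding closure_approachable
  proof (intro allI impI)
    fix e :: real assume "0 < e"
    have "a + c * b \<in> closure U" using assms by simp
    moreover have "0 < \<bar>c\<bar> * e" using \<open>0 < e\<close> \<open>c \<noteq> 0\<close> by simp
    ultimately obtain u where u: "u \<in> U" "dist u (a + c * b) < \<bar>c\<bar> * e"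
      unfolding closure_approachable by blast
    have "u - (a + c * b) = c * ((u - a) / c - b)" using \<open>c \<noteq> 0\<close> by (simp add: field_simps)
    then have "\<bar>c\<bar> * dist ((u - a) / c) b < \<bar>c\<bar> * e"
      using u(2) by (simp add: dist_real_def abs_mult)
    then have "dist ((u - a) / c) b < e" using \<open>c \<noteq> 0\<close> by simp
    then show "\<exists>y\<in>{b. a + c * b \<in> U}. dist y b < e"
      using u(1) \<open>c \<noteq> 0\<close> by (intro bexI[of _ "(u - a) / c"]) auto
  qed
  then show "closure {b. a + c * b \<in> U} = UNIV" by blast
qed

text \<open>For fixed g, m, n, k the condition puts an affine function of b with slope n - m x into
  \<open>U k\<close>. Irrationality makes the slope nonzero, so each condition holds on a dense open
  set, and there are countably many.\<close>

lemma generic_extension: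
  fixes U :: "nat \<Rightarrow> real set" and S :: "real set"
  assumes U: "\<And>k. open (U k)" "\<And>k. closure (U k) = UNIV"
    and "countable S" and x: "x \<notin> \<rat>"
  shows "\<exists>b. \<forall>g\<in>S. \<forall>m n::int. m \<noteq> 0 \<or> n \<noteq> 0 \<longrightarrow> g + of_int m * (y - x * b) + of_int n * b \<in> (\<Inter>k. U k)"
proof -
  define I where "I = S \<times> {(m :: int, n :: int). m \<noteq> 0 \<or> n \<noteq> 0} \<times> (UNIV :: nat set)"
  define V where "V = (\<lambda>(g, (m, n), k). {b. (g + of_int m * y) + (of_int n - of_int m * x) * b \<in> U k})"
  have "countable I" unfolding I_def using \<open>countable S\<close> by (intro countable_SIGMA) auto
  have V: "open (V i) \<and> closure (V i) = UNIV" if "i \<in> I" for i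
  proof -
    obtain g m n k where i: "i = (g, (m, n), k)" by (cases i) auto
    have "of_int n - of_int m * x \<noteq> 0"
    proof
      assume *: "of_int n - of_int m * x = 0"
      then have "m \<noteq> 0" using that i by (auto simp: I_def)
      then have "x = of_int n / of_int m" using * by (simp add: field_simps)
      then show False using x by (simp add: Rats_divide)
    qed
    then show ?thesis using dense_affine_vimage U by (simp add: V_def i)
  qed
  have "UNIV \<subseteq> closure (\<Inter>(V ` I))"
    using V \<open>countable I\<close> by (intro Baire) auto
  then have "\<Inter>(V ` I) \<noteq> {}" by (metis UNIV_not_empty closure_empty subset_empty)
  then obtain b where b: "\<And>i. i \<in> I \<Longrightarrow> b \<in> V i" by blast
  show ?thesis
  proof (intro exI ballI allI impI INT_I)
    fix g k and m n :: int assume "g \<in> S" "m \<noteq> 0 \<or> n \<noteq> 0"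
    then have "b \<in> V (g, (m, n), k)" by (intro b) (auto simp: I_def)
    then show "g + of_int m * (y - x * b) + of_int n * b \<in> U k"
      by (simp add: V_def algebra_simps)
  qed
qed

text \<open>Spans over the integers are the generated additive subgroups.\<close>

interpretation int_module: module "\<lambda>(n :: int) (x :: real). of_int n * x"
  by unfold_locales (auto simp: algebra_simps)

lemma countable_int_span:
  assumes "countable S"
  shows "countable (int_module.span S)"
proof -
  define F where "F = (\<lambda>l :: (int \<times> real) list. \<Sum>(c, x)\<leftarrow>l. of_int c * x)"
  have "x \<in> F ` lists (UNIV \<times> S)" if "x \<in> int_module.span S" for x
    using that
  proof (induction rule: int_module.span_induct_alt)
    case base
    show ?case by (intro image_eqI[of _ _ "[]"]) (auto simp: F_def)
  next
    case (step c x y)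
    then obtain l where "l \<in> lists (UNIV \<times> S)" "y = F l" by blast
    then show ?case using step
      by (intro image_eqI[of _ _ "(c, x) # l"]) (auto simp: F_def)
  qed
  then have "int_module.span S \<subseteq> F ` lists (UNIV \<times> S)" by blast
  moreover have "countable (F ` lists (UNIV \<times> S))"
    using assms by (intro countable_image countable_lists countable_SIGMA) auto
  ultimately show ?thesis by (rule countable_subset)
qed

section \<open>Transfinite construction of the group\<close>

text \<open>The pair \<open>(x, y)\<close> stands for the task of writing \<open>y\<close> as \<open>a + x * b\<close> with \<open>a\<close> and \<open>b\<close> in the
  group; \<open>f (x, y)\<close> is the value of \<open>b\<close>.\<close>

definition task_generators :: "(real \<times> real \<Rightarrow> real) \<Rightarrow> (real \<times> real) set \<Rightarrow> real set" where
  "task_generators f Q = (\<Union>p\<in>{p \<in> Q. fst p \<notin> \<rat>}. {snd p - fst p * f p, f p})"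

lemma task_generators_mono: "Q \<subseteq> Q' \<Longrightarrow> task_generators f Q \<subseteq> task_generators f Q'"
  unfolding task_generators_def by blast

lemma task_generators_insert:
  "task_generators f (insert p Q) = (if fst p \<in> \<rat> then task_generators f Q
     else insert (snd p - fst p * f p) (insert (f p) (task_generators f Q)))"
  unfolding task_generators_def by auto

lemma countable_task_generators: "countable Q \<Longrightarrow> countable (task_generators f Q)"
  unfolding task_generators_def by (intro countable_UN) auto

text \<open>Provides the congruence for well-founded choice: the requirement at a task sees
  \<open>f\<close> only on earlier tasks.\<close>

lemma task_generators_cong:
  "(\<And>q. q \<in> Q \<Longrightarrow> f q = g q) \<Longrightarrow> task_generators f Q = task_generators g Q"
  unfolding task_generators_def by auto

text \<open>A combination involves finitely many tasks, and the last of them bounds the others. The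
  alternative 0 accounts for empty \<open>J\<close>.\<close>

lemma span_task_generators_initial:
  fixes R :: "(real \<times> real) rel"
  assumes R: "trans R" "\<And>p q. (p, q) \<in> R \<or> p = q \<or> (q, p) \<in> R"
    and g: "g \<in> int_module.span (task_generators f J)"
  shows "g = 0 \<or> (\<exists>p\<in>J. g \<in> int_module.span (task_generators f (insert p {q. (q, p) \<in> R})))"
  using g
proof (induction rule: int_module.span_induct_alt)
  case base
  then show ?case by simp
next
  case (step c x y)
  let ?L = "\<lambda>p. int_module.span (task_generators f (insert p {q. (q, p) \<in> R}))"
  have L_mono: "?L p \<subseteq> ?L q" if "(p, q) \<in> R" for p q
    by (intro int_module.span_mono task_generators_mono)
      (use that R(1) in \<open>unfold trans_def, blast\<close>)
  obtain p where "p \<in> J" "x \<in> task_generators f (insert p {q. (q, p) \<in> R})"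
    using step(1) unfolding task_generators_def by blast
  then have p: "p \<in> J" "x \<in> ?L p" by (auto intro: int_module.span_base)
  have "\<exists>q\<in>J. x \<in> ?L q \<and> y \<in> ?L q"
    using step(2)
  proof
    assume "y = 0"
    then show ?thesis using p int_module.span_zero by blast
  next
    assume "\<exists>q\<in>J. y \<in> ?L q"
    then obtain q where q: "q \<in> J" "y \<in> ?L q" by blast
    show ?thesis using R(2)[of p q] p q L_mono[of p q] L_mono[of q p] by blast
  qed
  then obtain q where "q \<in> J" "x \<in> ?L q" "y \<in> ?L q" by blast
  then have "of_int c * x + y \<in> ?L q" by (intro int_module.span_add int_module.span_scale)
  then show ?case using \<open>q \<in> J\<close> by blast
qed

text \<open>Each \<open>f p\<close> is chosen generic over the span of the earlier generators.
  Induction along \<open>R\<close> keeps the span of every initial segment inside the intersection,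
  and these spans exhaust \<open>A\<close>.\<close>

lemma generic_group_exists:
  fixes U :: "nat \<Rightarrow> real set"
  assumes continuum_hypothesis
    and U: "\<And>k. open (U k)" "\<And>k. closure (U k) = UNIV" "\<And>k. 0 \<in> U k"
  obtains A where "subgroup A real_add_group" "A \<subseteq> (\<Inter>k. U k)"
    "\<And>x y. x \<notin> \<rat> \<Longrightarrow> \<exists>a\<in>A. \<exists>b\<in>A. y = a + x * b"
proof -
  obtain R :: "(real \<times> real) rel" where R: "wf R" "trans R"
      "\<And>p q. (p, q) \<in> R \<or> p = q \<or> (q, p) \<in> R" "\<And>p. countable {q. (q, p) \<in> R}"
    using continuum_hypothesis_wellorder[OF assms(1)] by blast
  define before where "before p = {q. (q, p) \<in> R}" for p
  define P where "P f p b \<longleftrightarrow> (fst p \<notin> \<rat> \<longrightarrow>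
      (\<forall>g\<in>int_module.span (task_generators f (before p)). \<forall>m n::int. m \<noteq> 0 \<or> n \<noteq> 0 \<longrightarrow>
        g + of_int m * (snd p - fst p * b) + of_int n * b \<in> (\<Inter>k. U k)))" for f p b
  have "\<exists>f. \<forall>p. P f p (f p)"
    using \<open>wf R\<close>
  proof (rule dependent_wf_choice)
    fix f g p b assume "\<And>q. (q, p) \<in> R \<Longrightarrow> f q = (g q :: real)"
    then have "task_generators f (before p) = task_generators g (before p)"
      by (intro task_generators_cong) (auto simp: before_def)
    then show "P f p b = P g p b" by (simp add: P_def)
  next
    fix p and f :: "real \<times> real \<Rightarrow> real"
    have "countable (int_module.span (task_generators f (before p)))"
      using R(4) by (intro countable_int_span countable_task_generators) (simp add: before_def)
    then show "\<exists>b. P f p b"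
      using generic_extension[OF U(1,2)] by (simp add: P_def)
  qed
  then obtain f where f: "\<And>p. P f p (f p)" by blast
  have initial: "int_module.span (task_generators f (insert p (before p))) \<subseteq> (\<Inter>k. U k)" for p
    using \<open>wf R\<close>
  proof (induction p rule: wf_induct_rule)
    case (less p)
    \<comment> \<open>There need be no last task before p, so each element is first located in the
      segment of some earlier task.\<close>
    have "int_module.span (task_generators f (before p)) \<subseteq> (\<Inter>k. U k)"
    proof
      fix g assume "g \<in> int_module.span (task_generators f (before p))"
      from span_task_generators_initial[OF R(2,3) this]
      show "g \<in> (\<Inter>k. U k)"
      proof
        assume "g = 0"
        then show ?thesis using U(3) by simp
      next
        assume "\<exists>q\<in>before p. g \<in> int_module.span (task_generators f (insert q {r. (r, q) \<in> R}))"
        then show ?thesis using less unfolding before_def by blast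
      qed
    qed
    note below = this
    show ?case
    proof (cases "fst p \<in> \<rat>")
      case True
      then show ?thesis using below by (simp add: task_generators_insert)
    next
      case False
      show ?thesis
      proof
        fix g assume "g \<in> int_module.span (task_generators f (insert p (before p)))"
        then obtain m n :: int where
          h: "g - of_int m * (snd p - fst p * f p) - of_int n * f p \<in> int_module.span (task_generators f (before p))"
          using False by (auto simp: task_generators_insert int_module.span_insert)
        show "g \<in> (\<Inter>k. U k)"
        \<comment> \<open>\<open>P\<close> says nothing about m = n = 0, but then g itself lies in
          the earlier span.\<close>
        proof (cases "m = 0 \<and> n = 0")
          case True
          then show ?thesis using h below by auto
        next
          case nz: False
          from f[of p] False h nz
          have "(g - of_int m * (snd p - fst p * f p) - of_int n * f p)
              + of_int m * (snd p - fst p * f p) + of_int n * f p \<in> (\<Inter>k. U k)"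
            unfolding P_def by blast
          then show ?thesis by simp
        qed
      qed
    qed
  qed
  define A where "A = int_module.span (task_generators f UNIV)"
  show ?thesis
  proof
    show "subgroup A real_add_group"
      unfolding subgroup_real_add_group_iff A_def
      using int_module.span_zero int_module.span_add int_module.span_neg by blast
    show "A \<subseteq> (\<Inter>k. U k)"
    proof
      fix g assume "g \<in> A"
      from span_task_generators_initial[OF R(2,3) this[unfolded A_def]]
      show "g \<in> (\<Inter>k. U k)"
      proof
        assume "g = 0"
        then show ?thesis using U(3) by simp
      next
        assume "\<exists>q\<in>UNIV. g \<in> int_module.span (task_generators f (insert q {r. (r, q) \<in> R}))"
        then show ?thesis using initial unfolding before_def by blast
      qed
    qed
    fix x y :: real assume "x \<notin> \<rat>"
    then have "y - x * f (x, y) \<in> A" "f (x, y) \<in> A"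
      unfolding A_def by (force intro!: int_module.span_base simp: task_generators_def)+
    then show "\<exists>a\<in>A. \<exists>b\<in>A. y = a + x * b"
      by (intro bexI[of _ "y - x * f (x, y)"] bexI[of _ "f (x, y)"]) auto
  qed
qed

section \<open>Rational x, and the conclusion\<close>

lemma subgroup_int_mult:
  assumes "subgroup A real_add_group" "a \<in> A"
  shows "of_int n * a \<in> A"
proof -
  have A: "0 \<in> A" "\<And>x y. x \<in> A \<Longrightarrow> y \<in> A \<Longrightarrow> x + y \<in> A" "\<And>x. x \<in> A \<Longrightarrow> - x \<in> A"
    using assms(1) by (auto simp: subgroup_real_add_group_iff)
  show ?thesis
  proof (induction n)
    case (nonneg n)
    show ?case by (induction n) (use A assms(2) in \<open>auto simp: distrib_right\<close>)
  next
    case (neg n)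
    have "of_nat m * a \<in> A" for m
      by (induction m) (use A assms(2) in \<open>auto simp: distrib_right\<close>)
    from A(3)[OF this[of "Suc n"]] show ?case by (simp add: algebra_simps)
  qed
qed

text \<open>With x = m/n, representing z/n in place of z clears the denominator: z = n a + m
  b.\<close>

lemma rational_sum_ne_UNIV:
  assumes A: "subgroup A real_add_group" "A \<noteq> UNIV" and x: "x \<in> \<rat>"
  shows "{a + x * b | a b. a \<in> A \<and> b \<in> A} \<noteq> UNIV"
proof
  assume eq: "{a + x * b | a b. a \<in> A \<and> b \<in> A} = UNIV"
  obtain m n :: int where n: "n > 0" "x = of_int m / of_int n"
    using x by (elim Rats_cases')
  have "z \<in> A" for z
  proof -
    obtain a b where ab: "z / of_int n = a + x * b" "a \<in> A" "b \<in> A"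
      using eq by blast
    then have "z = of_int n * a + of_int m * b" using n by (simp add: field_simps)
    then show ?thesis
      using ab subgroup_int_mult[OF A(1)] A(1) by (simp add: subgroup_real_add_group_iff)
  qed
  then show False using A(2) by blast
qed

text \<open>The identity is expanding with C = s = 1. This shows that a group of null 1-dimensional
  measure is proper.\<close>

lemma hausdorff_measure_1_UNIV: "hausdorff_measure 1 (UNIV :: real set) \<noteq> 0"
  by (rule hausdorff_measure_ne_0_if_expanding[of "\<lambda>y. y" _ 1]) (auto simp: dist_real_def)

theorem theorem1p4:
  shows "(\<exists>(A :: real set) (x :: real).
            subgroup A real_add_group \<and> fsigma A \<and> hausdorff_dim A = 1 / 2 \<and>
            {a + x * b | a b. a \<in> A \<and> b \<in> A} = UNIV) \<and>
         (continuum_hypothesis \<longrightarrow>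
          (\<exists>A :: real set.
            subgroup A real_add_group \<and> hausdorff_dim A = 0 \<and>
            (\<forall>x :: real. x \<notin> \<rat> \<longleftrightarrow> {a + x * b | a b. a \<in> A \<and> b \<in> A} = UNIV)))"
proof (intro conjI impI)
  have "y \<in> {a + (1 + sqrt 5) / 2 * b | a b. a \<in> lacunary_group \<and> b \<in> lacunary_group}" for y
    using lacunary_group_sum_golden_ratio[of y] by blast
  then have "{a + (1 + sqrt 5) / 2 * b | a b. a \<in> lacunary_group \<and> b \<in> lacunary_group} = UNIV"
    by (intro equalityI subsetI UNIV_I)
  then show "\<exists>(A :: real set) (x :: real).
      subgroup A real_add_group \<and> fsigma A \<and> hausdorff_dim A = 1 / 2 \<and>
      {a + x * b | a b. a \<in> A \<and> b \<in> A} = UNIV"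
    using subgroup_lacunary_group fsigma_lacunary_group hausdorff_dim_lacunary_group
    by (intro exI conjI)
next
  assume continuum_hypothesis
  obtain U :: "nat \<Rightarrow> real set" where U: "\<And>n. open (U n)" "\<And>n. closure (U n) = UNIV" "\<And>n. 0 \<in> U n"
      "\<And>s. 0 < s \<Longrightarrow> hausdorff_measure s (\<Inter>n. U n) = 0"
    by (rule dense_open_null_sets) blast
  obtain A where A: "subgroup A real_add_group" "A \<subseteq> (\<Inter>k. U k)"
      "\<And>x y. x \<notin> \<rat> \<Longrightarrow> \<exists>a\<in>A. \<exists>b\<in>A. y = a + x * b"
    by (rule generic_group_exists[where U = U, OF \<open>continuum_hypothesis\<close> U(1-3)]) blast
  have null: "hausdorff_measure s A = 0" if "0 < s" for s
    using hausdorff_measure_mono[OF A(2), of s] U(4)[OF that] by simp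
  have "hausdorff_dim A \<le> ennreal 0"
    using null by (intro hausdorff_dim_leI) auto
  then have "hausdorff_dim A = 0" by simp
  have "A \<noteq> UNIV"
    using null[of 1] hausdorff_measure_1_UNIV by auto
  have "x \<notin> \<rat> \<longleftrightarrow> {a + x * b | a b. a \<in> A \<and> b \<in> A} = UNIV" for x
  proof
    assume "x \<notin> \<rat>"
    then have "y \<in> {a + x * b | a b. a \<in> A \<and> b \<in> A}" for y
      using A(3)[of x y] by blast
    then show "{a + x * b | a b. a \<in> A \<and> b \<in> A} = UNIV"
      by (intro equalityI subsetI UNIV_I)
  qed (use rational_sum_ne_UNIV[OF A(1) \<open>A \<noteq> UNIV\<close>] in blast)
  then show "\<exists>A :: real set. subgroup A real_add_group \<and> hausdorff_dim A = 0 \<and>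
      (\<forall>x :: real. x \<notin> \<rat> \<longleftrightarrow> {a + x * b | a b. a \<in> A \<and> b \<in> A} = UNIV)"
    using A(1) \<open>hausdorff_dim A = 0\<close> by (intro exI[of _ A] conjI allI)
qed

end
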